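(* Let $n\ge 2$ with $\gcd(3,n)=1$, and let $T(3,n)$ be the $(3,n)$-torus knot. The irreducible traceless $\mathrm{SU}(2)$ characters of $T(3,n)$ are in bijection with the traceless arcs (the arcs of irreducible characters that contain a traceless point), one per arc. Exactly $(\det T(3,n)-1)/2$ of these characters are binary-dihedral: one if $n$ is even (where $\det T(3,n)=3$) and none if $n$ is odd (where $\det T(3,n)=1$). In particular, for $n$ odd every irreducible traceless character of $T(3,n)$ is non-dihedral.
   Context: Write $\pi_1(S^3\setminus T(3,n))=\langle x,y\mid x^3=y^n\rangle$. Characters are conjugacy classes of representations into $\mathrm{SU}(2)$, identified with the unit quaternions. A representation is traceless if every meridian is sent to an element of trace zero; a meridian is $x^ay^b$ with integers $a,b$ satisfying $an+3b=1$ (well defined up to the center, generated by $x^3=y^n$, which irreducible representations send to $\pm1$, so tracelessness is unaffected). Representation arcs: every irreducible $\rho$ has the form $\rho(x)=e^{\alpha\hat u}$, $\rho(y)=e^{\beta\hat v}$ with $\hat u,\hat v$ unit imaginary quaternions, $\alpha=\pi\ell_1/3$, $\beta=\pi\ell_2/n$, $\ell_1\in\{1,2\}$, $0<\ell_2<n$, $\ell_1\equiv\ell_2\pmod 2$, and the angle $\psi=\angle(\hat u,\hat v)\in(0,\pi)$ is the only remaining parameter. For each such pair $(\ell_1,\ell_2)$ the resulting one-parameter family (parametrized by $\psi\in(0,\pi)$) of irreducible characters is called a representation arc. A traceless arc is a representation arc that contains a traceless character. A representation is binary-dihedral if, after conjugation, its image lies in $\mathrm{Pin}(2)=S^1\cup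 jS^1$, where $S^1=\{e^{i\phi}\}$ in the unit quaternions. *)

theory Defs
  imports "HOL-Analysis.Analysis" "HOL-Algebra.Group"
    "HOL-Computational_Algebra.Polynomial_Factorial"
begin

section \<open>The group \<open>\<langle>x, y | x\<^sup>3 = y\<^sup>n\<rangle>\<close> of the torus knot \<open>T(3,n)\<close>\<close>

datatype generator = Gen_x | Gen_y

definition relator_lhs :: "generator list" where
  "relator_lhs = replicate 3 Gen_x"

definition relator_rhs :: "nat \<Rightarrow> generator list" where
  "relator_rhs n = replicate n Gen_y"

text \<open>The letter \<open>(g, True)\<close> stands for \<open>g\<close> and \<open>(g, False)\<close> for its formal inverse.\<close>

type_synonym word = "(generator \<times> bool) list"

definition positive_word :: "generator list \<Rightarrow> word" where
  "positive_word = map (\<lambda>g. (g, True))"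

inductive word_eq :: "nat \<Rightarrow> word \<Rightarrow> word \<Rightarrow> bool" for n :: nat where
  word_refl: "word_eq n w w"
| word_sym: "word_eq n v w \<Longrightarrow> word_eq n w v"
| word_trans: "word_eq n u v \<Longrightarrow> word_eq n v w \<Longrightarrow> word_eq n u w"
| word_cancel: "word_eq n (u @ [(g, e), (g, \<not> e)] @ v) (u @ v)"
| word_relation:
    "word_eq n (u @ positive_word relator_lhs @ v) (u @ positive_word (relator_rhs n) @ v)"

definition word_class :: "nat \<Rightarrow> word \<Rightarrow> word set" where
  "word_class n w = {v. word_eq n w v}"

definition knot_group :: "nat \<Rightarrow> word set monoid" where
  "knot_group n =
     \<lparr>carrier = range (word_class n),
      monoid.mult = (\<lambda>A B. {w. \<exists>a\<in>A. \<exists>b\<in>B. word_eq n (a @ b) w}),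
      one = word_class n []\<rparr>"

definition gen_x :: "nat \<Rightarrow> word set" where
  "gen_x n = word_class n [(Gen_x, True)]"

definition gen_y :: "nat \<Rightarrow> word set" where
  "gen_y n = word_class n [(Gen_y, True)]"

lemma word_eq_append:
  assumes "word_eq n a a'" and "word_eq n b b'"
  shows "word_eq n (a @ b) (a' @ b')"
proof -
  have right: "word_eq n (u @ c) (v @ c)" if "word_eq n u v" for u v c
    using that
  proof induction
    case (word_cancel u g e v)
    then show ?case using word_eq.word_cancel[of n u g e "v @ c"] by simp
  next
    case (word_relation u v)
    then show ?case using word_eq.word_relation[of n u "v @ c"] by simp
  qed (blast intro: word_eq.intros)+
  have left: "word_eq n (c @ u) (c @ v)" if "word_eq n u v" for u v c
    using that
  proof induction
    case (word_cancel u g e v)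
    then show ?case using word_eq.word_cancel[of n "c @ u" g e v] by simp
  next
    case (word_relation u v)
    then show ?case using word_eq.word_relation[of n "c @ u" v] by simp
  qed (blast intro: word_eq.intros)+
  show ?thesis
    using right[OF assms(1)] left[OF assms(2)] by (blast intro: word_trans)
qed

lemma word_class_eq_iff: "word_class n v = word_class n w \<longleftrightarrow> word_eq n v w"
  unfolding word_class_def by (auto intro: word_eq.intros)

lemma knot_group_mult:
  "word_class n v \<otimes>\<^bsub>knot_group n\<^esub> word_class n w = word_class n (v @ w)"
  unfolding knot_group_def word_class_def
  by (auto intro: word_eq_append word_refl word_sym word_trans)

lemma word_inverse:
  "word_eq n (rev (map (\<lambda>(g, e). (g, \<not> e)) w) @ w) []"
proof (induction w)
  case Nil
  then show ?case by (simp add: word_refl)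
next
  case (Cons l w)
  obtain g e where l: "l = (g, e)" by fastforce
  let ?r = "rev (map (\<lambda>(g, e). (g, \<not> e)) w)"
  have "word_eq n (?r @ [(g, \<not> e), (g, \<not> \<not> e)] @ w) (?r @ w)"
    by (rule word_cancel)
  then show ?case using Cons l by (auto intro: word_trans)
qed

lemma knot_group_is_group: "group (knot_group n)"
proof (rule groupI)
  fix a assume "a \<in> carrier (knot_group n)"
  then obtain w where w: "a = word_class n w" by (auto simp: knot_group_def)
  show "\<exists>b\<in>carrier (knot_group n). b \<otimes>\<^bsub>knot_group n\<^esub> a = \<one>\<^bsub>knot_group n\<^esub>"
  proof (rule bexI)
    show "word_class n (rev (map (\<lambda>(g, e). (g, \<not> e)) w)) \<otimes>\<^bsub>knot_group n\<^esub> a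
            = \<one>\<^bsub>knot_group n\<^esub>"
      by (simp add: w knot_group_mult)
         (simp add: knot_group_def word_class_eq_iff word_inverse)
  qed (simp add: knot_group_def)
next
  have one: "\<one>\<^bsub>knot_group n\<^esub> = word_class n []" by (simp add: knot_group_def)
  have carr: "carrier (knot_group n) = range (word_class n)" by (simp add: knot_group_def)
  show "\<one>\<^bsub>knot_group n\<^esub> \<in> carrier (knot_group n)" by (simp add: one carr)
  show "a \<otimes>\<^bsub>knot_group n\<^esub> b \<in> carrier (knot_group n)"
    if "a \<in> carrier (knot_group n)" "b \<in> carrier (knot_group n)" for a b
    using that by (auto simp: carr knot_group_mult)
  show "a \<otimes>\<^bsub>knot_group n\<^esub> b \<otimes>\<^bsub>knot_group n\<^esub> c = a \<otimes>\<^bsub>knot_group n\<^esub> (b \<otimes>\<^bsub>knot_group n\<^esub> c)"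
    if "a \<in> carrier (knot_group n)" "b \<in> carrier (knot_group n)"
       "c \<in> carrier (knot_group n)" for a b c
    using that by (auto simp: carr knot_group_mult)
  show "\<one>\<^bsub>knot_group n\<^esub> \<otimes>\<^bsub>knot_group n\<^esub> a = a" if "a \<in> carrier (knot_group n)" for a
    using that by (auto simp: carr one knot_group_mult)
qed


section \<open>The determinant of \<open>T(3,n)\<close>\<close>

text \<open>
  Fox derivatives of positive words, pushed forward along a map \<open>\<phi>\<close> from the generators
  to a commutative ring: \<open>\<partial>(h w)/\<partial>g = \<partial>h/\<partial>g + \<phi>(h) \<partial>w/\<partial>g\<close>.
\<close>

primrec fox_derivative ::
  "(generator \<Rightarrow> int poly) \<Rightarrow> generator \<Rightarrow> generator list \<Rightarrow> int poly" where
  "fox_derivative \<phi> g [] = 0"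
| "fox_derivative \<phi> g (h # w) = (if h = g then 1 else 0) + \<phi> h * fox_derivative \<phi> g w"

text \<open>
  The abelianization of the knot group is infinite cyclic, with \<open>x \<mapsto> t\<^sup>n\<close> and \<open>y \<mapsto> t\<^sup>3\<close>,
  so that the meridian \<open>x\<^sup>a y\<^sup>b\<close>, \<open>a n + 3 b = 1\<close>, goes to \<open>t\<close>.
\<close>

definition abelianization :: "nat \<Rightarrow> generator \<Rightarrow> int poly" where
  "abelianization n g = (case g of Gen_x \<Rightarrow> monom 1 n | Gen_y \<Rightarrow> monom 1 3)"

definition alexander_entry :: "nat \<Rightarrow> generator \<Rightarrow> int poly" where
  "alexander_entry n g =
     fox_derivative (abelianization n) g relator_lhs
     - fox_derivative (abelianization n) g (relator_rhs n)"

text \<open>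
  The presentation has two generators and one relation, so the Alexander matrix is a single row
  of two entries, and the Alexander polynomial, determined up to units \<open>\<plusminus>t\<^sup>k\<close>, is the greatest
  common divisor of its \<open>1 \<times> 1\<close> minors. The units do not affect \<open>\<bar>\<Delta>(-1)\<bar>\<close>.
\<close>

definition alexander_polynomial :: "nat \<Rightarrow> int poly" where
  "alexander_polynomial n = gcd (alexander_entry n Gen_x) (alexander_entry n Gen_y)"

definition knot_det :: "nat \<Rightarrow> int" where
  "knot_det n = \<bar>poly (alexander_polynomial n) (-1)\<bar>"


section \<open>\<open>SU(2)\<close> and the unit quaternions\<close>

definition SU2 :: "(complex^2^2) monoid" where
  "SU2 = \<lparr>carrier = {A. A ** map_matrix cnj (transpose A) = mat 1 \<and> det A = 1},
          monoid.mult = (**),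
          one = mat 1\<rparr>"

text \<open>
  The quaternion \<open>a + b i + c j + d k\<close> is the matrix with rows
  \<open>(a + b \<i>, c + d \<i>)\<close> and \<open>(- c + d \<i>, a - b \<i>)\<close>; \<open>SU(2)\<close> is the set of unit quaternions.
\<close>

definition quat_i :: "complex^2^2" where
  "quat_i = vector [vector [\<i>, 0], vector [0, - \<i>]]"

definition quat_j :: "complex^2^2" where
  "quat_j = vector [vector [0, 1], vector [- 1, 0]]"

definition quat_k :: "complex^2^2" where
  "quat_k = vector [vector [0, \<i>], vector [\<i>, 0]]"

definition imag_quat :: "real^3 \<Rightarrow> complex^2^2" where
  "imag_quat u = (u $ 1) *\<^sub>R quat_i + (u $ 2) *\<^sub>R quat_j + (u $ 3) *\<^sub>R quat_k"

definition quat_exp :: "complex^2^2 \<Rightarrow> complex^2^2" where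
  "quat_exp A = (\<Sum>k. (1 / fact k) *\<^sub>R (((**) A) ^^ k) (mat 1))"

definition unit_angle :: "real^3 \<Rightarrow> real^3 \<Rightarrow> real" where
  "unit_angle u v = arccos (u \<bullet> v)"

definition circle :: "(complex^2^2) set" where
  "circle = range (\<lambda>\<phi>::real. quat_exp (\<phi> *\<^sub>R quat_i))"

definition Pin2 :: "(complex^2^2) set" where
  "Pin2 = circle \<union> (\<lambda>z. quat_j ** z) ` circle"


section \<open>Representations and characters\<close>

type_synonym rep = "word set \<Rightarrow> complex^2^2"

definition representations :: "nat \<Rightarrow> rep set" where
  "representations n = hom (knot_group n) SU2 \<inter> extensional (carrier (knot_group n))"

definition irreducible_rep :: "nat \<Rightarrow> rep \<Rightarrow> bool" where
  "irreducible_rep n \<rho> \<longleftrightarrow>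
     (\<forall>W. vec.subspace W \<and> (\<forall>g\<in>carrier (knot_group n). \<forall>w\<in>W. \<rho> g *v w \<in> W)
            \<longrightarrow> W = {0} \<or> W = UNIV)"

definition traceless_rep :: "nat \<Rightarrow> rep \<Rightarrow> bool" where
  "traceless_rep n \<rho> \<longleftrightarrow>
     (\<forall>a b :: int. a * int n + 3 * b = 1 \<longrightarrow>
        trace (\<rho> (gen_x n [^]\<^bsub>knot_group n\<^esub> a \<otimes>\<^bsub>knot_group n\<^esub> gen_y n [^]\<^bsub>knot_group n\<^esub> b)) = 0)"

definition binary_dihedral_rep :: "nat \<Rightarrow> rep \<Rightarrow> bool" where
  "binary_dihedral_rep n \<rho> \<longleftrightarrow>
     (\<exists>A\<in>carrier SU2. \<forall>g\<in>carrier (knot_group n). A \<otimes>\<^bsub>SU2\<^esub> \<rho> g \<otimes>\<^bsub>SU2\<^esub> inv\<^bsub>SU2\<^esub> A \<in> Pin2)"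

definition character :: "nat \<Rightarrow> rep \<Rightarrow> rep set" where
  "character n \<rho> =
     {\<sigma> \<in> representations n.
        \<exists>A\<in>carrier SU2. \<forall>g\<in>carrier (knot_group n). \<sigma> g = A \<otimes>\<^bsub>SU2\<^esub> \<rho> g \<otimes>\<^bsub>SU2\<^esub> inv\<^bsub>SU2\<^esub> A}"

definition irreducible_traceless_characters :: "nat \<Rightarrow> rep set set" where
  "irreducible_traceless_characters n =
     character n ` {\<rho> \<in> representations n. irreducible_rep n \<rho> \<and> traceless_rep n \<rho>}"

definition binary_dihedral_character :: "nat \<Rightarrow> rep set \<Rightarrow> bool" where
  "binary_dihedral_character n \<xi> \<longleftrightarrow> (\<exists>\<rho>\<in>\<xi>. binary_dihedral_rep n \<rho>)"


section \<open>Representation arcs\<close>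

definition arc_point :: "nat \<Rightarrow> nat \<Rightarrow> nat \<Rightarrow> real \<Rightarrow> rep \<Rightarrow> bool" where
  "arc_point n l1 l2 \<psi> \<rho> \<longleftrightarrow>
     \<rho> \<in> representations n \<and> irreducible_rep n \<rho> \<and>
     (\<exists>u v :: real^3. norm u = 1 \<and> norm v = 1 \<and> unit_angle u v = \<psi> \<and>
        \<rho> (gen_x n) = quat_exp ((pi * real l1 / 3) *\<^sub>R imag_quat u) \<and>
        \<rho> (gen_y n) = quat_exp ((pi * real l2 / real n) *\<^sub>R imag_quat v))"

definition representation_arc :: "nat \<Rightarrow> nat \<Rightarrow> nat \<Rightarrow> rep set set" where
  "representation_arc n l1 l2 =
     {character n \<rho> | \<rho> \<psi>. 0 < \<psi> \<and> \<psi> < pi \<and> arc_point n l1 l2 \<psi> \<rho>}"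

definition representation_arcs :: "nat \<Rightarrow> rep set set set" where
  "representation_arcs n =
     {representation_arc n l1 l2 | l1 l2.
        l1 \<in> {1, 2} \<and> 0 < l2 \<and> l2 < n \<and> l1 mod 2 = l2 mod 2}"

definition traceless_arcs :: "nat \<Rightarrow> rep set set set" where
  "traceless_arcs n =
     {A \<in> representation_arcs n. \<exists>\<xi>\<in>A. \<exists>\<rho>\<in>\<xi>. traceless_rep n \<rho>}"

end

theory Submission
  imports Defs
begin

text \<open>
  For irreducible \<open>\<rho>\<close> the images \<open>\<rho>(x) = e\<^sup>\<alpha>\<^sup>u\<close> and \<open>\<rho>(y) = e\<^sup>\<beta>\<^sup>v\<close> do not commute, so \<open>x\<^sup>3 = y\<^sup>n\<close> forces
  \<open>sin 3\<alpha> = sin n\<beta> = 0\<close>: this gives the labels of an arc, and the traces of \<open>\<rho>(x)\<close>, \<open>\<rho>(y)\<close>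
  recover them, so that distinct arcs are disjoint. On an arc, the trace of the meridian \<open>x\<^sup>a y\<^sup>b\<close> is
  \<open>2 (cos a\<alpha> cos b\<beta> - sin a\<alpha> sin b\<beta> cos \<psi>)\<close>, whose last coefficient does not vanish; hence
  tracelessness determines \<open>cos \<psi>\<close>, and \<open>(u, v)\<close> up to simultaneous rotation. A binary-dihedral \<open>\<rho>\<close>
  must send \<open>x\<close> into the circle, because \<open>\<rho>(x)\<close> has trace \<open>\<plusminus>1\<close>, and therefore \<open>y\<close> into \<open>j S\<^sup>1\<close>, so that
  \<open>\<beta> = \<pi>/2\<close> and \<open>2 \<ell>\<^sub>2 = n\<close>. Conversely \<open>x \<mapsto> e\<^sup>\<alpha>\<^sup>i\<close>, \<open>y \<mapsto> j\<close> realizes this case.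
\<close>

section \<open>The determinant\<close>

lemma fox_derivative_replicate:
  "fox_derivative \<phi> g (replicate k h) = (if h = g then (\<Sum>i<k. \<phi> h ^ i) else 0)"
  by (induction k) (auto simp: lessThan_Suc_eq_insert_0 sum.reindex sum_distrib_left
      simp flip: power_Suc)

lemma alexander_entries:
  "alexander_entry n Gen_x = (\<Sum>i<3. monom 1 n ^ i)"
  "alexander_entry n Gen_y = - (\<Sum>i<n. monom 1 3 ^ i)"
  by (simp_all add: alexander_entry_def relator_lhs_def relator_rhs_def
      fox_derivative_replicate abelianization_def)

text \<open>Modulo \<open>1 + t + t\<^sup>2\<close> three consecutive powers of \<open>t\<close>
  cancel, so only the first \<open>n mod 3\<close> terms of the sum survive. Coprimality excludes
  residue \<open>0\<close>; what is left is \<open>1\<close>, or \<open>1 + t\<close>, which is then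
  a unit with inverse \<open>- t\<close>.\<close>

lemma coprime_cyclotomic3_geometric_sum:
  fixes t :: "'a :: comm_ring_1"
  assumes "coprime 3 n"
  shows "\<exists>u v. u * (1 + t + t\<^sup>2) + v * (\<Sum>i<n. t ^ i) = 1"
proof -
  have period: "\<exists>w. (\<Sum>i<3 * k + r. t ^ i) = (\<Sum>i<r. t ^ i) + w * (1 + t + t\<^sup>2)" for k r
  proof (induction k)
    case 0
    show ?case by (rule exI[of _ 0]) simp
  next
    case (Suc k)
    then obtain w where "(\<Sum>i<3 * k + r. t ^ i) = (\<Sum>i<r. t ^ i) + w * (1 + t + t\<^sup>2)" ..
    moreover have "3 * Suc k + r = Suc (Suc (Suc (3 * k + r)))"
      by simp
    ultimately have "(\<Sum>i<3 * Suc k + r. t ^ i)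
        = (\<Sum>i<r. t ^ i) + (w + t ^ (3 * k + r)) * (1 + t + t\<^sup>2)"
      by (simp only: sum.lessThan_Suc) (simp add: algebra_simps power2_eq_square)
    then show ?case by blast
  qed
  define r where "r = n mod 3"
  obtain w where w: "(\<Sum>i<n. t ^ i) = (\<Sum>i<r. t ^ i) + w * (1 + t + t\<^sup>2)"
    using period[of "n div 3" r] by (auto simp: r_def)
  have "\<not> 3 dvd n"
    using assms by (metis coprime_common_divisor_nat dvd_refl numeral_eq_one_iff semiring_norm(86))
  then have "r = 1 \<or> r = 2"
    unfolding r_def by presburger
  then consider "r = 1" | "r = 2" by blast
  then show ?thesis
  proof cases
    case 1
    have "(- w) * (1 + t + t\<^sup>2) + 1 * (\<Sum>i<n. t ^ i) = 1"
      unfolding w 1 by simp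
    then show ?thesis by blast
  next
    case 2
    \<comment> \<open>Here \<open>t * (1 + t)\<close> is one less than
      \<open>1 + t + t\<^sup>2\<close>, so multiplying by \<open>- t\<close> leaves
      \<open>1\<close>; the summand \<open>t * w\<close> compensates for the quotient
      \<open>w\<close>.\<close>
    have "(1 + t * w) * (1 + t + t\<^sup>2) + (- t) * (\<Sum>i<n. t ^ i) = 1"
      unfolding w 2 by (simp add: numeral_2_eq_2 algebra_simps)
    then show ?thesis by blast
  qed
qed

text \<open>
  With \<open>\<Phi> = (t\<^sup>3\<^sup>n - 1) (t - 1) / ((t\<^sup>3 - 1) (t\<^sup>n - 1))\<close>, the two Alexander entries are
  \<open>\<Phi> (1 + t + t\<^sup>2)\<close> and \<open>- \<Phi> (1 + t + \<dots> + t\<^sup>n\<^sup>-\<^sup>1)\<close>, and the cofactors are coprime.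
\<close>

lemma alexander_polynomial_cofactor:
  assumes "coprime 3 n"
  shows "\<bar>poly (alexander_polynomial n) (-1)\<bar> = \<bar>poly (\<Sum>i<3. monom 1 n ^ i) (-1)\<bar>"
proof -
  define t :: "int poly" where "t = monom 1 1"
  define c where "c = 1 + t + t\<^sup>2"
  define P where "P = (\<Sum>i<3. (t ^ n) ^ i)"
  define Q where "Q = (\<Sum>i<n. (t ^ 3) ^ i)"
  define R where "R = (\<Sum>i<n. t ^ i)"
  have mon: "monom 1 k = t ^ k" for k
    by (simp add: t_def monom_power)
  have t3: "t ^ 3 - 1 = (t - 1) * c"
    unfolding c_def by (simp add: algebra_simps power2_eq_square power3_eq_cube)
  obtain u v where uv: "u * c + v * R = 1"
    using coprime_cyclotomic3_geometric_sum[OF assms] unfolding c_def R_def by blast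
  have tn: "t ^ n - 1 = (t - 1) * R"
    unfolding R_def by (rule power_diff_1_eq)
  have P: "t ^ (3 * n) - 1 = (t ^ n - 1) * P"
    unfolding P_def by (subst power_diff_1_eq[symmetric]) (simp add: mult.commute flip: power_mult)
  have Q: "t ^ (3 * n) - 1 = (t ^ 3 - 1) * Q"
    unfolding Q_def by (subst power_diff_1_eq[symmetric]) (simp add: mult.commute flip: power_mult)
  have nz: "t - 1 \<noteq> 0"
  proof
    assume "t - 1 = 0"
    then have "poly (t - 1) 0 = 0" by simp
    then show False by (simp add: t_def poly_monom)
  qed
  have "(t - 1) * (R * P) = (t - 1) * (c * Q)"
    using P Q unfolding t3 tn by (simp only: mult.assoc)
  then have RP: "R * P = c * Q"
    using nz mult_left_cancel by blast
  \<comment> \<open>\<open>F\<close> is the polynomial \<Phi>, obtained without division: the Bezout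
    coefficients of \<open>c\<close> and \<open>R\<close> are applied to \<open>P\<close> and
    \<open>Q\<close>, and \<open>RP\<close> then yields both factorisations.\<close>
  define F where "F = u * P + v * Q"
  have Pc: "P = F * c"
  proof -
    have "P = (u * c + v * R) * P" using uv by simp
    also have "\<dots> = u * P * c + v * (R * P)" by (simp add: algebra_simps)
    finally show ?thesis unfolding RP F_def by (simp add: algebra_simps)
  qed
  have QR: "Q = F * R"
  proof -
    have "Q = (u * c + v * R) * Q" using uv by simp
    also have "\<dots> = u * (c * Q) + v * Q * R" by (simp add: algebra_simps)
    finally show ?thesis unfolding RP[symmetric] F_def by (simp add: algebra_simps)
  qed
  have "coprime c R"
  proof (rule coprimeI)
    fix d assume "d dvd c" "d dvd R"
    then have "d dvd u * c + v * R" by simp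
    then show "d dvd 1" using uv by simp
  qed
  then have "gcd P Q = normalize F"
    unfolding Pc QR by (simp add: gcd_mult_left)
  \<comment> \<open>Normalising an integer polynomial multiplies it by the sign of its leading
    coefficient, which the absolute value discards.\<close>
  moreover have "\<bar>poly (normalize F) x\<bar> = \<bar>poly F x\<bar>" for x
  proof (cases "F = 0")
    case False
    have "poly F x = sgn (lead_coeff F) * poly (normalize F) x"
      by (subst unit_factor_mult_normalize[of F, symmetric])
         (simp add: unit_factor_poly_def poly_monom del: unit_factor_mult_normalize)
    then show ?thesis
      using False by (simp add: abs_mult)
  qed simp
  moreover have "alexander_polynomial n = gcd P Q"
    unfolding alexander_polynomial_def alexander_entries P_def Q_def mon by simp
  \<comment> \<open>The cofactor \<open>c\<close> takes the value \<open>1 - 1 + 1 = 1\<close> at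
    \<open>-1\<close>.\<close>
  moreover have "poly P (-1) = poly F (-1)"
    unfolding Pc c_def t_def by (simp add: poly_monom)
  ultimately show ?thesis
    unfolding P_def mon by simp
qed

text \<open>The three summands take the values \<open>1\<close>, \<open>(-1)^n\<close> and
  \<open>1\<close> at \<open>-1\<close>.\<close>

lemma knot_det_eq:
  assumes "coprime 3 n"
  shows "knot_det n = (if even n then 3 else 1)"
  unfolding knot_det_def alexander_polynomial_cofactor[OF assms]
  by (simp add: poly_sum poly_monom numeral_3_eq_3)

section \<open>Quaternion matrices\<close>

text \<open>Keeping real and imaginary parts apart turns matrix products into dot and cross products
  in \<open>real^3\<close>.\<close>

definition quat :: "real \<Rightarrow> real^3 \<Rightarrow> complex^2^2" where
  "quat a u = a *\<^sub>R mat 1 + imag_quat u"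

lemma quat_nth:
  "quat a u $ 1 $ 1 = Complex a (u $ 1)"
  "quat a u $ 1 $ 2 = Complex (u $ 2) (u $ 3)"
  "quat a u $ 2 $ 1 = Complex (- (u $ 2)) (u $ 3)"
  "quat a u $ 2 $ 2 = Complex a (- (u $ 1))"
  by (simp_all add: quat_def imag_quat_def quat_i_def quat_j_def quat_k_def mat_def complex_eq_iff)

lemma quat_eq_iff [simp]: "quat a u = quat b v \<longleftrightarrow> a = b \<and> u = v"
  by (auto simp: vec_eq_iff forall_2 forall_3 quat_nth)

lemma quat_mult:
  "quat a u ** quat b v = quat (a * b - u \<bullet> v) (a *\<^sub>R v + b *\<^sub>R u + cross3 u v)"
  by (simp add: vec_eq_iff forall_2 sum_2
      matrix_matrix_mult_def quat_nth complex_eq_iff cross3_def inner_vec_def sum_3 algebra_simps)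

lemma mat_1_eq_quat: "mat 1 = quat 1 0"
  by (simp add: quat_def imag_quat_def)

lemma imag_quat_eq_quat: "imag_quat u = quat 0 u"
  by (simp add: quat_def)

lemma scaleR_quat: "c *\<^sub>R quat a u = quat (c * a) (c *\<^sub>R u)"
  by (simp add: quat_def imag_quat_def algebra_simps)

lemma quat_0 [simp]: "quat 0 0 = 0"
  by (simp add: quat_def imag_quat_def)

lemma quat_eq_0_iff: "quat a u = 0 \<longleftrightarrow> a = 0 \<and> u = 0"
  by (metis quat_0 quat_eq_iff)

lemma quat_add: "quat a u + quat b v = quat (a + b) (u + v)"
  by (simp add: quat_def imag_quat_def algebra_simps)

lemma quat_minus: "- quat a u = quat (- a) (- u)"
  using scaleR_quat[of "-1" a u] by simp

lemma trace_quat: "trace (quat a u) = of_real (2 * a)"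
  by (simp add: trace_def sum_2 quat_nth complex_eq_iff)

lemma det_quat: "det (quat a u) = of_real (a\<^sup>2 + u \<bullet> u)"
  by (simp add: det_2 quat_nth complex_eq_iff inner_vec_def sum_3 power2_eq_square)

lemma quat_in_SU2_iff: "quat a u \<in> carrier SU2 \<longleftrightarrow> a\<^sup>2 + u \<bullet> u = 1"
proof -
  have "map_matrix cnj (transpose (quat a u)) = quat a (- u)"
    by (simp add: vec_eq_iff forall_2 map_matrix_def transpose_def quat_nth complex_eq_iff)
  then show ?thesis
    by (auto simp: SU2_def quat_mult mat_1_eq_quat det_quat power2_eq_square
        simp del: of_real_add)
qed

text \<open>For a unitary matrix of determinant one the adjoint equals the adjugate, so the first
  row determines the second.\<close>

lemma SU2_eq_quat:
  assumes "A \<in> carrier SU2"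
  obtains a u where "A = quat a u" and "a\<^sup>2 + u \<bullet> u = 1"
proof -
  define p q r s where "p = A $ 1 $ 1" and "q = A $ 1 $ 2" and "r = A $ 2 $ 1" and "s = A $ 2 $ 2"
  note defs = p_def q_def r_def s_def
  have *: "A ** map_matrix cnj (transpose A) = mat 1" "det A = 1"
    using assms by (auto simp: SU2_def)
  have eqs: "p * cnj p + q * cnj q = 1" "p * cnj r + q * cnj s = 0" "r * cnj p + s * cnj q = 0"
    "p * s - q * r = 1"
    using * by (simp_all add: vec_eq_iff forall_2 matrix_matrix_mult_def sum_2 map_matrix_def
        transpose_def mat_def det_2 defs)
  \<comment> \<open>Ring identities that combine the unitarity and determinant equations; after
    substituting \<open>eqs\<close> only \<open>cnj p\<close> and \<open>- cnj q\<close> remain on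
    the right.\<close>
  have "s = cnj p * (p * s - q * r) + q * (r * cnj p + s * cnj q) - s * (p * cnj p + q * cnj q - 1)"
    "r = - cnj q * (p * s - q * r) + p * (r * cnj p + s * cnj q) - r * (p * cnj p + q * cnj q - 1)"
    by (simp_all add: algebra_simps)
  then have s: "s = cnj p" and r: "r = - cnj q"
    unfolding eqs by simp_all
  let ?u = "vector [Im p, Re q, Im q] :: real^3"
  have "A = quat (Re p) ?u"
    using s r by (simp add: vec_eq_iff forall_2 quat_nth complex_eq_iff defs)
  then show ?thesis
    using that[of "Re p" ?u] assms quat_in_SU2_iff by blast
qed

lemma quat_inverse:
  assumes "a\<^sup>2 + u \<bullet> u = 1"
  shows "quat a (- u) ** quat a u = mat 1" and "quat a u ** quat a (- u) = mat 1"
  using assms by (simp_all add: quat_mult mat_1_eq_quat power2_eq_square)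

lemma SU2_mult [simp]: "A \<otimes>\<^bsub>SU2\<^esub> B = A ** B"
  and SU2_one [simp]: "\<one>\<^bsub>SU2\<^esub> = mat 1"
  by (simp_all add: SU2_def)

text \<open>The squared norm of a quaternion is its determinant, so closure is multiplicativity of
  \<open>det\<close>. Inverses are quaternion conjugates.\<close>

lemma SU2_group: "group SU2"
proof (rule groupI)
  fix A B assume "A \<in> carrier SU2" "B \<in> carrier SU2"
  then obtain a u b v where AB: "A = quat a u" "a\<^sup>2 + u \<bullet> u = 1" "B = quat b v" "b\<^sup>2 + v \<bullet> v = 1"
    by (elim SU2_eq_quat)
  obtain c w where cw: "quat a u ** quat b v = quat c w"
    unfolding quat_mult by blast
  have "of_real (c\<^sup>2 + w \<bullet> w) = det (quat a u) * det (quat b v)"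
    unfolding det_quat[symmetric] cw[symmetric] by (rule det_mul)
  also have "\<dots> = of_real 1"
    unfolding det_quat AB by simp
  finally show "A \<otimes>\<^bsub>SU2\<^esub> B \<in> carrier SU2"
    unfolding of_real_eq_iff by (simp add: AB(1,3) cw quat_in_SU2_iff)
next
  fix A assume "A \<in> carrier SU2"
  then obtain a u where A: "A = quat a u" "a\<^sup>2 + u \<bullet> u = 1"
    by (rule SU2_eq_quat)
  then have "quat a (- u) \<in> carrier SU2" by (simp add: quat_in_SU2_iff)
  then show "\<exists>B\<in>carrier SU2. B \<otimes>\<^bsub>SU2\<^esub> A = \<one>\<^bsub>SU2\<^esub>"
    using quat_inverse(1)[OF A(2)] A(1) by auto
next
  show "\<one>\<^bsub>SU2\<^esub> \<in> carrier SU2"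
    by (simp add: mat_1_eq_quat quat_in_SU2_iff)
qed (simp_all add: matrix_mul_assoc)

interpretation SU2: group SU2
  by (rule SU2_group)

section \<open>Exponentials of imaginary unit quaternions\<close>

definition expq :: "real \<Rightarrow> real^3 \<Rightarrow> complex^2^2" where
  "expq \<theta> u = quat (cos \<theta>) (sin \<theta> *\<^sub>R u)"

text \<open>A unit imaginary quaternion squares to \<open>-1\<close>, so the exponential series
  splits into a cosine series along \<open>mat 1\<close> and a sine series along \<open>u\<close>.
  Everything afterwards uses this closed form.\<close>

lemma quat_exp_imag:
  assumes "norm u = 1"
  shows "quat_exp (\<theta> *\<^sub>R imag_quat u) = expq \<theta> u"
proof -
  have uu: "u \<bullet> u = 1" using assms by (simp add: norm_eq_1)
  \<comment> \<open>The coefficients \<open>cos_coeff k\<close> and \<open>sin_coeff k\<close>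
    contain \<open>1 / fact k\<close>; the factor \<open>fact k\<close> removes it to describe the
    bare power.\<close>
  have "(((**) (\<theta> *\<^sub>R imag_quat u)) ^^ k) (mat 1)
      = quat (fact k * (cos_coeff k * \<theta> ^ k)) ((fact k * (sin_coeff k * \<theta> ^ k)) *\<^sub>R u)" for k
    by (induction k) (simp_all add: mat_1_eq_quat imag_quat_eq_quat scaleR_quat quat_mult uu
        cos_coeff_Suc sin_coeff_Suc cross_mult_left cross_mult_right divide_simps)
  then have pow: "(1 / fact k) *\<^sub>R (((**) (\<theta> *\<^sub>R imag_quat u)) ^^ k) (mat 1)
      = (cos_coeff k * \<theta> ^ k) *\<^sub>R mat 1 + (sin_coeff k * \<theta> ^ k) *\<^sub>R imag_quat u" for k
    by (simp add: scaleR_quat mat_1_eq_quat imag_quat_eq_quat quat_add)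
  have "(\<lambda>k. (1 / fact k) *\<^sub>R (((**) (\<theta> *\<^sub>R imag_quat u)) ^^ k) (mat 1))
     sums (cos \<theta> *\<^sub>R mat 1 + sin \<theta> *\<^sub>R imag_quat u)"
    unfolding pow
    using cos_converges[of \<theta>] sin_converges[of \<theta>] by (auto intro!: sums_add sums_scaleR_left)
  then show ?thesis
    by (simp add: quat_exp_def sums_iff quat_def expq_def imag_quat_def algebra_simps)
qed

lemma expq_add:
  assumes "norm u = 1"
  shows "expq \<theta> u ** expq \<phi> u = expq (\<theta> + \<phi>) u"
  using assms by (simp add: expq_def quat_mult cos_add sin_add norm_eq_1 cross_mult_left
      cross_mult_right algebra_simps)

lemma expq_in_SU2: "norm u = 1 \<Longrightarrow> expq \<theta> u \<in> carrier SU2"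
  by (simp add: expq_def quat_in_SU2_iff norm_eq_1 flip: power2_eq_square)

lemma expq_inv: "norm u = 1 \<Longrightarrow> inv\<^bsub>SU2\<^esub> (expq \<theta> u) = expq (- \<theta>) u"
  by (rule SU2.inv_equality) (simp_all add: expq_add expq_in_SU2, simp add: expq_def mat_1_eq_quat)

lemma expq_nat_pow:
  assumes "norm u = 1"
  shows "expq \<theta> u [^]\<^bsub>SU2\<^esub> (k :: nat) = expq (real k * \<theta>) u"
  by (induction k) (simp_all add: assms expq_add algebra_simps, simp add: expq_def mat_1_eq_quat)

lemma expq_int_pow:
  assumes "norm u = 1"
  shows "expq \<theta> u [^]\<^bsub>SU2\<^esub> (k :: int) = expq (of_int k * \<theta>) u"
  by (cases k rule: int_cases2)
     (simp_all add: assms int_pow_int SU2.int_pow_neg_int expq_nat_pow expq_in_SU2 expq_inv)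

lemma trace_expq: "trace (expq \<theta> u) = of_real (2 * cos \<theta>)"
  by (simp add: expq_def trace_quat)

lemma trace_expq_mult:
  "trace (expq \<theta> u ** expq \<phi> v) = of_real (2 * (cos \<theta> * cos \<phi> - sin \<theta> * sin \<phi> * (u \<bullet> v)))"
  by (simp add: expq_def trace_quat quat_mult)

lemma SU2_eq_expq:
  assumes "A \<in> carrier SU2"
  obtains \<theta> u where "0 \<le> \<theta>" "\<theta> \<le> pi" "norm u = 1" "A = expq \<theta> u"
proof -
  obtain a u where A: "A = quat a u" and 1: "a\<^sup>2 + u \<bullet> u = 1"
    using SU2_eq_quat[OF assms] .
  \<comment> \<open>For \<open>u = 0\<close> the matrix is \<open>1\<close> or \<open>-1\<close> and
    any axis will do; \<open>axis 1 1\<close> is a default.\<close>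
  define w :: "real^3" where "w = (if u = 0 then axis 1 1 else u /\<^sub>R norm u)"
  have "a\<^sup>2 + (norm u)\<^sup>2 = 1" using 1 by (simp add: power2_norm_eq_inner)
  moreover have "a\<^sup>2 \<le> 1" using calculation by (smt (verit) zero_le_power2)
  ultimately have "\<bar>a\<bar> \<le> 1" "norm u = sin (arccos a)"
    by (auto simp: abs_square_le_1 sin_arccos_abs intro: real_sqrt_unique[symmetric])
  moreover have "norm w = 1" "norm u *\<^sub>R w = u" by (auto simp: w_def norm_axis_1)
  ultimately show ?thesis
    using that[of "arccos a" w] A by (auto simp: expq_def abs_le_iff arccos_lbound arccos_ubound)
qed

lemma quat_normalize:
  assumes "quat a w \<noteq> 0"
  obtains c where "c *\<^sub>R quat a w \<in> carrier SU2"
proof -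
  have "a\<^sup>2 + w \<bullet> w \<noteq> 0"
    using assms by (simp add: quat_eq_0_iff add_nonneg_eq_0_iff)
  then have "0 < a\<^sup>2 + w \<bullet> w" by (metis add_nonneg_nonneg inner_ge_zero less_eq_real_def zero_le_power2)
  define k where "k = inverse (sqrt (a\<^sup>2 + w \<bullet> w))"
  have "(k * a)\<^sup>2 + (k *\<^sub>R w) \<bullet> (k *\<^sub>R w) = k\<^sup>2 * (a\<^sup>2 + w \<bullet> w)"
    by (simp add: power2_eq_square algebra_simps)
  also have "\<dots> = 1"
    using \<open>0 < a\<^sup>2 + w \<bullet> w\<close> by (simp add: k_def power_inverse)
  finally show ?thesis
    using that[of k] by (simp add: scaleR_quat quat_in_SU2_iff)
qed

section \<open>Conjugation of imaginary quaternions\<close>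

lemma cross_cross_left: "cross3 (cross3 u v) w = (u \<bullet> w) *\<^sub>R v - (v \<bullet> w) *\<^sub>R u"
  by (simp add: cross_skew[of _ w] Lagrange inner_commute)

lemma matrix_add_rdistrib: "(A + B) ** C = A ** C + B ** C"
  by (simp add: matrix_matrix_mult_def vec_eq_iff sum.distrib algebra_simps)

lemma scaleR_matrix_mult:
  fixes A B :: "complex^'n^'n"
  shows "(c *\<^sub>R A) ** B = c *\<^sub>R (A ** B)" and "A ** (c *\<^sub>R B) = c *\<^sub>R (A ** B)"
  by (simp_all add: matrix_matrix_mult_def vec_eq_iff scaleR_sum_right)

text \<open>For orthogonal \<open>u\<close>, the quaternion \<open>|w|\<^sup>2 - w' w\<close> commutes with \<open>u\<close> and conjugates \<open>w\<close> to \<open>w'\<close>;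
  it vanishes only if \<open>w' = - w\<close>, in which case \<open>u\<close> itself works.\<close>

lemma SU2_conj_fixing:
  fixes u w w' :: "real^3"
  assumes u: "norm u = 1" "u \<bullet> w = 0" "u \<bullet> w' = 0" and w: "norm w = norm w'"
  obtains q where "q \<in> carrier SU2" "q ** imag_quat w = imag_quat w' ** q"
    "q ** imag_quat u = imag_quat u ** q"
proof (cases "w' = - w")
  case True
  have "quat 0 u ** imag_quat w = imag_quat w' ** quat 0 u"
    using u cross_skew[of u w] by (simp add: True imag_quat_eq_quat quat_mult inner_commute)
  then show ?thesis
    using that[of "quat 0 u"] u by (simp add: quat_in_SU2_iff norm_eq_1 imag_quat_eq_quat)
next
  case False
  let ?q = "quat (w \<bullet> w + w \<bullet> w') (cross3 w w')"
  have ww: "w' \<bullet> w' = w \<bullet> w" using w by (simp add: norm_eq)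
  have "?q \<noteq> 0"
  proof
    assume "?q = 0"
    then have "w \<bullet> w + w \<bullet> w' = 0"
      by (simp add: quat_eq_0_iff)
    then have "(w + w') \<bullet> (w + w') = 0"
      by (simp add: inner_add_left inner_add_right ww inner_commute)
    then show False using False by (simp add: add_eq_0_iff)
  qed
  then obtain c where c: "c *\<^sub>R ?q \<in> carrier SU2" by (rule quat_normalize)
  have "?q ** imag_quat w = imag_quat w' ** ?q"
    using cross_skew[of w' "cross3 w w'"]
    by (simp add: imag_quat_eq_quat quat_mult cross_cross_left dot_cross_self ww inner_commute
        algebra_simps)
  moreover have "?q ** imag_quat u = imag_quat u ** ?q"
    using cross_skew[of u "cross3 w w'"] u
    by (simp add: imag_quat_eq_quat quat_mult cross_cross_left inner_commute)
  ultimately show ?thesis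
    using that[OF c] by (simp add: scaleR_matrix_mult)
qed

text \<open>Three dimensions leave room for a unit vector orthogonal to both \<open>w\<close> and
  \<open>w'\<close>, which serves as the fixed axis in \<open>SU2_conj_fixing\<close>.\<close>

lemma SU2_conj_vector:
  fixes w w' :: "real^3"
  assumes "norm w = norm w'"
  obtains q where "q \<in> carrier SU2" "q ** imag_quat w = imag_quat w' ** q"
proof -
  have "dim {w, w'} < DIM(real^3)"
    using dim_le_card'[of "{w, w'}"] card_insert_le_m1[of 2 "{w'}" w] by (auto simp: card_insert_if)
  then obtain x where x: "x \<noteq> 0" "\<And>y. y \<in> span {w, w'} \<Longrightarrow> orthogonal x y"
    using orthogonal_to_subspace_exists by blast
  then have "norm (sgn x) = 1" "sgn x \<bullet> w = 0" "sgn x \<bullet> w' = 0"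
    by (auto simp: orthogonal_def span_base norm_sgn sgn_div_norm)
  then show ?thesis
    using SU2_conj_fixing[of "sgn x" w w'] assms that by blast
qed

text \<open>Conjugation preserves the trace, hence keeps the real part at zero.\<close>

lemma SU2_conj_imag:
  assumes "q \<in> carrier SU2"
  obtains v' where "q ** imag_quat v = imag_quat v' ** q"
proof -
  obtain a w where q: "q = quat a w" "a\<^sup>2 + w \<bullet> w = 1"
    using SU2_eq_quat[OF assms] .
  obtain b v' where v': "q ** imag_quat v ** quat a (- w) = quat b v'"
    unfolding q imag_quat_eq_quat quat_mult by blast
  have "trace (quat b v') = trace (quat a (- w) ** (q ** imag_quat v))"
    unfolding v'[symmetric] by (rule trace_mul_sym)
  also have "\<dots> = 0"
    by (simp add: matrix_mul_assoc q quat_inverse imag_quat_eq_quat trace_quat)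
  finally have "b = 0" by (simp add: trace_quat)
  moreover have "q ** imag_quat v = quat b v' ** q"
    using q quat_inverse by (simp flip: v' matrix_mul_assoc)
  ultimately show ?thesis
    using that by (simp add: imag_quat_eq_quat)
qed

text \<open>The inner product is \<open>- 1 / 2\<close> times the trace of the product of the two
  imaginary quaternions, and traces are conjugation invariant.\<close>

lemma inner_conj_imag:
  assumes "q \<in> carrier SU2"
    and u: "q ** imag_quat u = imag_quat u' ** q" and v: "q ** imag_quat v = imag_quat v' ** q"
  shows "u' \<bullet> v' = u \<bullet> v"
proof -
  obtain a w where q: "q = quat a w" "a\<^sup>2 + w \<bullet> w = 1"
    using SU2_eq_quat[OF assms(1)] .
  have tr: "trace (imag_quat x ** imag_quat y) = of_real (- 2 * (x \<bullet> y))" for x y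
    by (simp add: imag_quat_eq_quat quat_mult trace_quat)
  have "imag_quat u' ** imag_quat v' = imag_quat u' ** imag_quat v' ** q ** quat a (- w)"
    using q quat_inverse by (simp flip: matrix_mul_assoc)
  also have "\<dots> = q ** (imag_quat u ** imag_quat v ** quat a (- w))"
    using u v by (metis matrix_mul_assoc)
  finally have "trace (imag_quat u' ** imag_quat v')
      = trace (q ** (imag_quat u ** imag_quat v ** quat a (- w)))"
    by simp
  also have "\<dots> = trace (imag_quat u ** imag_quat v ** quat a (- w) ** q)"
    by (rule trace_mul_sym)
  also have "\<dots> = trace (imag_quat u ** imag_quat v)"
    using q quat_inverse by (simp flip: matrix_mul_assoc)
  finally show ?thesis unfolding tr of_real_eq_iff by simp
qed

text \<open>First \<open>u\<close> is moved to \<open>u'\<close>, then a rotation about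
  \<open>u'\<close> adjusts the second vector. Subtracting the common component \<open>c\<close>
  along \<open>u'\<close> leaves vectors of equal length orthogonal to \<open>u'\<close>, as
  \<open>SU2_conj_fixing\<close> requires.\<close>

lemma SU2_conj_pair:
  fixes u v u' v' :: "real^3"
  assumes "norm u = 1" "norm v = 1" "norm u' = 1" "norm v' = 1" "u \<bullet> v = u' \<bullet> v'"
  obtains q where "q \<in> carrier SU2" "q ** imag_quat u = imag_quat u' ** q"
    "q ** imag_quat v = imag_quat v' ** q"
proof -
  obtain p where p: "p \<in> carrier SU2" "p ** imag_quat u = imag_quat u' ** p"
    using SU2_conj_vector[of u u'] assms by metis
  obtain v1 where v1: "p ** imag_quat v = imag_quat v1 ** p"
    using SU2_conj_imag[OF p(1)] .
  have ip: "u' \<bullet> v1 = u \<bullet> v" "v1 \<bullet> v1 = v \<bullet> v"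
    using inner_conj_imag[OF p(1)] p(2) v1 by auto
  define c where "c = u \<bullet> v"
  have uu: "u' \<bullet> u' = 1" using assms by (simp add: norm_eq_1)
  have vv: "v1 \<bullet> v1 = v' \<bullet> v'" using assms ip by (simp add: norm_eq_1)
  have "norm (v1 - c *\<^sub>R u') = norm (v' - c *\<^sub>R u')"
    unfolding norm_eq using assms(5) ip vv
    by (simp add: inner_diff_left inner_diff_right inner_commute c_def)
  then obtain r where r: "r \<in> carrier SU2" "r ** imag_quat (v1 - c *\<^sub>R u') = imag_quat (v' - c *\<^sub>R u') ** r"
      "r ** imag_quat u' = imag_quat u' ** r"
    using SU2_conj_fixing[of u' "v1 - c *\<^sub>R u'" "v' - c *\<^sub>R u'"] assms ip uu
    by (auto simp: inner_diff_right c_def)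
  have "imag_quat x = imag_quat (x - c *\<^sub>R u') + c *\<^sub>R imag_quat u'" for x
    by (simp add: imag_quat_eq_quat quat_add scaleR_quat)
  then have "r ** imag_quat v1 = imag_quat v' ** r"
    using r matrix_add_ldistrib[of r] matrix_add_rdistrib[of _ _ r] scaleR_matrix_mult by metis
  then have "(r ** p) ** imag_quat v = imag_quat v' ** (r ** p)"
    by (metis matrix_mul_assoc v1)
  moreover have "(r ** p) ** imag_quat u = imag_quat u' ** (r ** p)"
    by (metis matrix_mul_assoc p(2) r(3))
  moreover have "r ** p \<in> carrier SU2"
    using SU2.m_closed[OF r(1) p(1)] by simp
  ultimately show ?thesis using that by blast
qed

section \<open>Representations and characters\<close>

lemma gen_in_carrier [simp]: "gen_x n \<in> carrier (knot_group n)" "gen_y n \<in> carrier (knot_group n)"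
  by (simp_all add: knot_group_def gen_x_def gen_y_def)

lemma word_class_Cons:
  "word_class n ((g, e) # w) =
     (if e then word_class n [(g, True)] else inv\<^bsub>knot_group n\<^esub> word_class n [(g, True)])
       \<otimes>\<^bsub>knot_group n\<^esub> word_class n w"
proof -
  interpret group "knot_group n" by (rule knot_group_is_group)
  have carr: "word_class n v \<in> carrier (knot_group n)" for v
    by (simp add: knot_group_def)
  have "word_class n [(g, False)] \<otimes>\<^bsub>knot_group n\<^esub> word_class n [(g, True)] = \<one>\<^bsub>knot_group n\<^esub>"
    using word_cancel[of n "[]" g False "[]"]
    by (simp add: knot_group_mult word_class_eq_iff) (simp add: knot_group_def word_class_eq_iff)
  then have "inv\<^bsub>knot_group n\<^esub> word_class n [(g, True)] = word_class n [(g, False)]"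
    using carr inv_equality by blast
  then show ?thesis by (simp add: knot_group_mult)
qed

text \<open>Reduces both intertwining relations and membership in \<open>Pin2\<close> to the
  generators and their inverses, by prepending letters to a word.\<close>

lemma knot_group_induct [consumes 1, case_names one x inv_x y inv_y]:
  assumes "a \<in> carrier (knot_group n)"
    and "P \<one>\<^bsub>knot_group n\<^esub>"
    and "\<And>a. a \<in> carrier (knot_group n) \<Longrightarrow> P a \<Longrightarrow> P (gen_x n \<otimes>\<^bsub>knot_group n\<^esub> a)"
    and "\<And>a. a \<in> carrier (knot_group n) \<Longrightarrow> P a \<Longrightarrow> P (inv\<^bsub>knot_group n\<^esub> gen_x n \<otimes>\<^bsub>knot_group n\<^esub> a)"
    and "\<And>a. a \<in> carrier (knot_group n) \<Longrightarrow> P a \<Longrightarrow> P (gen_y n \<otimes>\<^bsub>knot_group n\<^esub> a)"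
    and "\<And>a. a \<in> carrier (knot_group n) \<Longrightarrow> P a \<Longrightarrow> P (inv\<^bsub>knot_group n\<^esub> gen_y n \<otimes>\<^bsub>knot_group n\<^esub> a)"
  shows "P a"
proof -
  obtain w where w: "a = word_class n w"
    using assms(1) by (auto simp: knot_group_def)
  have "P (word_class n w)"
  proof (induction w)
    case Nil
    then show ?case using assms(2) by (simp add: knot_group_def)
  next
    case (Cons l w)
    obtain g e where l: "l = (g, e)" by fastforce
    have "word_class n w \<in> carrier (knot_group n)" by (simp add: knot_group_def)
    with Cons assms(3-6) show ?case
      unfolding l by (cases g; cases e; subst word_class_Cons) (simp_all flip: gen_x_def gen_y_def)
  qed
  then show ?thesis by (simp add: w)
qed

lemma knot_group_relation: "gen_x n [^]\<^bsub>knot_group n\<^esub> (3::nat) = gen_y n [^]\<^bsub>knot_group n\<^esub> n"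
proof -
  interpret group "knot_group n" by (rule knot_group_is_group)
  have "word_class n (replicate k (g, True)) = word_class n [(g, True)] [^]\<^bsub>knot_group n\<^esub> k" for g k
  proof (induction k)
    case (Suc k)
    have "word_class n (replicate (Suc k) (g, True)) = word_class n (replicate k (g, True) @ [(g, True)])"
      by (simp add: replicate_append_same)
    then show ?case using Suc by (simp flip: knot_group_mult)
  qed (simp add: knot_group_def)
  moreover have "word_class n (replicate 3 (Gen_x, True)) = word_class n (replicate n (Gen_y, True))"
    using word_relation[of n "[]" "[]"]
    by (simp add: word_class_eq_iff positive_word_def relator_lhs_def relator_rhs_def)
  ultimately show ?thesis by (simp add: gen_x_def gen_y_def)
qed

text \<open>The universal property of the presentation: evaluation \<open>ev\<close> of words
  respects cancellation and the relator, so it descends to word classes.\<close>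

lemma (in group) knot_group_hom_exists:
  assumes "x \<in> carrier G" "y \<in> carrier G" "x [^] (3::nat) = y [^] n"
  shows "\<exists>h \<in> hom (knot_group n) G. h (gen_x n) = x \<and> h (gen_y n) = y"
proof -
  define V where "V g = (case g of Gen_x \<Rightarrow> x | Gen_y \<Rightarrow> y)" for g
  have V [simp]: "V g \<in> carrier G" for g
    using assms by (simp add: V_def split: generator.split)
  define L where "L l = (if snd l then V (fst l) else inv V (fst l))" for l
  have L [simp]: "L l \<in> carrier G" for l
    by (simp add: L_def)
  define ev where "ev w = foldr (\<lambda>l a. L l \<otimes> a) w \<one>" for w
  have ev_simps [simp]: "ev [] = \<one>" "ev (l # w) = L l \<otimes> ev w" for l w
    by (simp_all add: ev_def)
  have ev [simp]: "ev w \<in> carrier G" for w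
    by (induction w) simp_all
  have ev_append: "ev (v @ w) = ev v \<otimes> ev w" for v w
    by (induction v) (simp_all add: m_assoc)
  have ev_replicate: "ev (replicate k (g, True)) = V g [^] k" for k g
    by (induction k) (simp_all add: L_def flip: nat_pow_Suc2 del: nat_pow_Suc)
  have ev_eq: "ev v = ev w" if "word_eq n v w" for v w
    using that
  proof induction
    case (word_cancel u g e v)
    have "L (g, e) \<otimes> (L (g, \<not> e) \<otimes> ev v) = ev v"
      by (cases e) (simp_all add: L_def flip: m_assoc)
    then show ?case by (simp add: ev_append)
  next
    case (word_relation u v)
    have "ev (positive_word relator_lhs) = ev (positive_word (relator_rhs n))"
      using assms by (simp add: positive_word_def relator_lhs_def relator_rhs_def ev_replicate V_def)
    then show ?case by (simp add: ev_append)
  qed simp_all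
  \<comment> \<open>A representative word is chosen; by \<open>ev_eq\<close> its value does not
    depend on the choice.\<close>
  define h where "h C = ev (SOME w. C = word_class n w)" for C
  have h: "h (word_class n w) = ev w" for w
  proof -
    have "word_class n w = word_class n (SOME v. word_class n w = word_class n v)"
      by (rule someI) (rule refl)
    then show ?thesis
      unfolding h_def by (metis ev_eq word_class_eq_iff)
  qed
  have carr: "carrier (knot_group n) = range (word_class n)"
    by (simp add: knot_group_def)
  have "h \<in> hom (knot_group n) G"
    by (rule homI) (auto simp: carr h knot_group_mult ev_append)
  then show ?thesis
    using assms by (intro bexI[of _ h]) (simp_all add: gen_x_def gen_y_def h L_def V_def)
qed

lemma (in group) inv_intertwine:
  assumes "a \<in> carrier G" "b \<in> carrier G" "c \<in> carrier G" "a \<otimes> b = c \<otimes> a"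
  shows "a \<otimes> inv b = inv c \<otimes> a"
proof -
  have "a \<otimes> inv b = inv c \<otimes> (c \<otimes> a) \<otimes> inv b"
    using assms(1-3) by (simp flip: m_assoc)
  also have "\<dots> = inv c \<otimes> (a \<otimes> b) \<otimes> inv b"
    by (simp only: assms(4))
  also have "\<dots> = inv c \<otimes> a"
    using assms(1-3) by (simp add: m_assoc)
  finally show ?thesis .
qed

text \<open>Intertwining passes to products and inverses. With \<open>h = h'\<close> this gives
  elements commuting with the whole image, otherwise conjugacy of two representations.\<close>

lemma (in group) hom_intertwine:
  assumes "h \<in> hom (knot_group n) G" "h' \<in> hom (knot_group n) G" "a \<in> carrier G"
    and "a \<otimes> h (gen_x n) = h' (gen_x n) \<otimes> a" "a \<otimes> h (gen_y n) = h' (gen_y n) \<otimes> a"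
    and "g \<in> carrier (knot_group n)"
  shows "a \<otimes> h g = h' g \<otimes> a"
proof -
  interpret K: group "knot_group n" by (rule knot_group_is_group)
  interpret h: group_hom "knot_group n" G h
    by unfold_locales (rule assms)
  interpret h': group_hom "knot_group n" G h'
    by unfold_locales (rule assms)
  have step: "a \<otimes> h (k \<otimes>\<^bsub>knot_group n\<^esub> g) = h' (k \<otimes>\<^bsub>knot_group n\<^esub> g) \<otimes> a"
    if "k \<in> carrier (knot_group n)" "g \<in> carrier (knot_group n)"
      "a \<otimes> h k = h' k \<otimes> a" "a \<otimes> h g = h' g \<otimes> a" for k g
  proof -
    have "a \<otimes> (h k \<otimes> h g) = h' k \<otimes> a \<otimes> h g"
      using that assms(3) by (simp flip: m_assoc)
    also have "\<dots> = h' k \<otimes> (h' g \<otimes> a)"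
      using that assms(3) by (simp add: m_assoc)
    also have "\<dots> = (h' k \<otimes> h' g) \<otimes> a"
      using that assms(3) by (simp add: m_assoc)
    finally show ?thesis using that by simp
  qed
  show ?thesis
    using assms(6)
  proof (induction rule: knot_group_induct)
    case one
    then show ?case using assms(3) by simp
  next
    case (x g)
    then show ?case by (intro step) (simp_all add: assms)
  next
    case (inv_x g)
    then show ?case by (intro step) (simp_all add: assms inv_intertwine)
  next
    case (y g)
    then show ?case by (intro step) (simp_all add: assms)
  next
    case (inv_y g)
    then show ?case by (intro step) (simp_all add: assms inv_intertwine)
  qed
qed

section \<open>Conjugacy classes of representations\<close>

lemma representations_hom:
  assumes "\<rho> \<in> representations n"
  shows "group_hom (knot_group n) SU2 \<rho>"
  using assms SU2_group knot_group_is_group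
  by (simp add: representations_def group_hom_def group_hom_axioms_def)

lemma SU2_eq_conj_iff:
  assumes "A \<in> carrier SU2" "X \<in> carrier SU2" "Y \<in> carrier SU2"
  shows "Y = A ** X ** inv\<^bsub>SU2\<^esub> A \<longleftrightarrow> A ** X = Y ** A"
  using SU2.inv_solve_right[of Y "A ** X" A] SU2.m_closed[of A X] assms by auto

lemma trace_conj:
  assumes "A \<in> carrier SU2"
  shows "trace (A ** X ** inv\<^bsub>SU2\<^esub> A) = trace X"
proof -
  have "trace (A ** X ** inv\<^bsub>SU2\<^esub> A) = trace (inv\<^bsub>SU2\<^esub> A ** A ** X)"
    by (subst trace_mul_sym) (simp add: matrix_mul_assoc)
  then show ?thesis using SU2.l_inv[OF assms] by simp
qed

text \<open>Stating conjugacy as an intertwining relation removes the inverse, so that relations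
  compose by associativity alone.\<close>

lemma character_iff:
  assumes "\<rho> \<in> representations n"
  shows "\<sigma> \<in> character n \<rho> \<longleftrightarrow> \<sigma> \<in> representations n \<and>
    (\<exists>A\<in>carrier SU2. \<forall>g\<in>carrier (knot_group n). A ** \<rho> g = \<sigma> g ** A)"
proof (cases "\<sigma> \<in> representations n")
  case True
  interpret \<rho>: group_hom "knot_group n" SU2 \<rho> by (rule representations_hom[OF assms])
  interpret \<sigma>: group_hom "knot_group n" SU2 \<sigma> by (rule representations_hom[OF True])
  show ?thesis
    using SU2_eq_conj_iff by (auto simp: character_def True)
qed (simp add: character_def)

lemma character_self:
  assumes "\<rho> \<in> representations n"
  shows "\<rho> \<in> character n \<rho>"
  using assms SU2.one_closed by (auto simp: character_iff intro!: bexI[of _ "mat 1"])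

lemma character_eq:
  assumes "\<rho> \<in> representations n" "\<sigma> \<in> character n \<rho>"
  shows "character n \<sigma> = character n \<rho>"
proof -
  obtain A where \<sigma>: "\<sigma> \<in> representations n" and A: "A \<in> carrier SU2"
    and eq: "\<And>g. g \<in> carrier (knot_group n) \<Longrightarrow> A ** \<rho> g = \<sigma> g ** A"
    using assms by (auto simp: character_iff)
  let ?A' = "inv\<^bsub>SU2\<^esub> A"
  have A': "?A' \<in> carrier SU2" "?A' ** A = mat 1" "A ** ?A' = mat 1"
    using A SU2.l_inv[OF A] SU2.r_inv[OF A] by simp_all
  have eq': "?A' ** \<sigma> g = \<rho> g ** ?A'" if "g \<in> carrier (knot_group n)" for g
  proof -
    have "?A' ** \<sigma> g = ?A' ** (\<sigma> g ** A) ** ?A'"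
      using A' by (simp flip: matrix_mul_assoc)
    also have "\<dots> = ?A' ** A ** \<rho> g ** ?A'"
      by (simp only: eq[OF that, symmetric] matrix_mul_assoc)
    finally show ?thesis using A' by simp
  qed
  have trans: "\<exists>C\<in>carrier SU2. \<forall>g\<in>carrier (knot_group n). C ** \<rho>1 g = \<rho>3 g ** C"
    if B: "B \<in> carrier SU2" "\<And>g. g \<in> carrier (knot_group n) \<Longrightarrow> B ** \<rho>1 g = \<rho>2 g ** B"
      and ex: "\<exists>C\<in>carrier SU2. \<forall>g\<in>carrier (knot_group n). C ** \<rho>2 g = \<rho>3 g ** C" for \<rho>1 \<rho>2 \<rho>3 B
  proof -
    obtain C where C: "C \<in> carrier SU2" "\<forall>g\<in>carrier (knot_group n). C ** \<rho>2 g = \<rho>3 g ** C"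
      using ex by blast
    have "(C ** B) ** \<rho>1 g = \<rho>3 g ** (C ** B)" if "g \<in> carrier (knot_group n)" for g
    proof -
      have "(C ** B) ** \<rho>1 g = C ** \<rho>2 g ** B"
        by (simp only: B(2)[OF that] flip: matrix_mul_assoc)
      also have "\<dots> = \<rho>3 g ** C ** B"
        using C(2) that by simp
      finally show ?thesis by (simp add: matrix_mul_assoc)
    qed
    moreover have "C ** B \<in> carrier SU2" using SU2.m_closed[OF C(1) B(1)] by simp
    ultimately show ?thesis by blast
  qed
  show ?thesis
    using trans[of A \<rho> \<sigma>, OF A eq] trans[of ?A' \<sigma> \<rho>, OF A'(1) eq']
    unfolding set_eq_iff character_iff[OF assms(1)] character_iff[OF \<sigma>] by blast
qed

lemma character_eqI:
  assumes "\<rho> \<in> representations n" "\<sigma> \<in> representations n" "A \<in> carrier SU2"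
    and "A ** \<rho> (gen_x n) = \<sigma> (gen_x n) ** A" "A ** \<rho> (gen_y n) = \<sigma> (gen_y n) ** A"
  shows "character n \<rho> = character n \<sigma>"
proof -
  have "A ** \<rho> g = \<sigma> g ** A" if "g \<in> carrier (knot_group n)" for g
    using SU2.hom_intertwine[of \<rho> n \<sigma> A g] assms that by (simp add: representations_def)
  then show ?thesis
    using assms by (intro character_eq[symmetric]) (auto simp: character_iff)
qed

lemma trace_character:
  assumes "\<rho> \<in> representations n" "\<sigma> \<in> character n \<rho>" "g \<in> carrier (knot_group n)"
  shows "trace (\<sigma> g) = trace (\<rho> g)"
  using assms trace_conj by (auto simp: character_def)

lemma traceless_character:
  assumes "\<rho> \<in> representations n" "\<sigma> \<in> character n \<rho>"
  shows "traceless_rep n \<sigma> \<longleftrightarrow> traceless_rep n \<rho>"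
proof -
  interpret K: group "knot_group n" by (rule knot_group_is_group)
  show ?thesis using trace_character[OF assms] by (simp add: traceless_rep_def)
qed

text \<open>A binary-dihedral character only promises some dihedral member; this transfers the
  property to the representative that carries the arc labels.\<close>

lemma binary_dihedral_rep_character:
  assumes "\<rho> \<in> representations n" "\<sigma> \<in> character n \<rho>" "binary_dihedral_rep n \<sigma>"
  shows "binary_dihedral_rep n \<rho>"
proof -
  obtain A where A: "A \<in> carrier SU2"
    and \<sigma>: "\<And>g. g \<in> carrier (knot_group n) \<Longrightarrow> \<sigma> g = A \<otimes>\<^bsub>SU2\<^esub> \<rho> g \<otimes>\<^bsub>SU2\<^esub> inv\<^bsub>SU2\<^esub> A"
    using assms by (auto simp: character_def)
  obtain B where B: "B \<in> carrier SU2"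
    and P: "\<And>g. g \<in> carrier (knot_group n) \<Longrightarrow> B \<otimes>\<^bsub>SU2\<^esub> \<sigma> g \<otimes>\<^bsub>SU2\<^esub> inv\<^bsub>SU2\<^esub> B \<in> Pin2"
    using assms(3) by (auto simp: binary_dihedral_rep_def)
  interpret \<rho>: group_hom "knot_group n" SU2 \<rho> by (rule representations_hom[OF assms(1)])
  have "(B \<otimes>\<^bsub>SU2\<^esub> A) \<otimes>\<^bsub>SU2\<^esub> \<rho> g \<otimes>\<^bsub>SU2\<^esub> inv\<^bsub>SU2\<^esub> (B \<otimes>\<^bsub>SU2\<^esub> A)
      = B \<otimes>\<^bsub>SU2\<^esub> \<sigma> g \<otimes>\<^bsub>SU2\<^esub> inv\<^bsub>SU2\<^esub> B" if "g \<in> carrier (knot_group n)" for g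
    unfolding \<sigma>[OF that] SU2.inv_mult_group[OF B A] by (simp add: matrix_mul_assoc)
  then show ?thesis
    using P SU2.m_closed[OF B A] unfolding binary_dihedral_rep_def by metis
qed

text \<open>The \<open>\<i>\<close>-eigenspace of a commuting imaginary unit quaternion is a proper invariant subspace.\<close>

lemma irreducible_no_commuting_imag:
  assumes \<rho>: "\<rho> \<in> representations n" and irr: "irreducible_rep n \<rho>" and u: "norm u = 1"
    and "imag_quat u ** \<rho> (gen_x n) = \<rho> (gen_x n) ** imag_quat u"
    and "imag_quat u ** \<rho> (gen_y n) = \<rho> (gen_y n) ** imag_quat u"
  shows False
proof -
  define B where "B = imag_quat u"
  have BSU2: "B \<in> carrier SU2"
    using u by (simp add: B_def imag_quat_eq_quat quat_in_SU2_iff norm_eq_1)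
  have comm: "B ** \<rho> g = \<rho> g ** B" if "g \<in> carrier (knot_group n)" for g
    using SU2.hom_intertwine[of \<rho> n \<rho> B g] assms that BSU2 by (simp add: representations_def B_def)
  have BB: "B *v (B *v w) = - w" for w
  proof -
    have "B ** B = - mat 1"
      using u by (simp add: B_def imag_quat_eq_quat quat_mult mat_1_eq_quat quat_minus norm_eq_1)
    then show ?thesis
      by (simp add: matrix_vector_mul_assoc)
         (simp add: matrix_vector_mult_def mat_def vec_eq_iff sum_2 forall_2)
  qed
  \<comment> \<open>The diagonal entries of \<open>B\<close> are opposite, so \<open>0\<close> is
    the only scalar by which \<open>B\<close> could act.\<close>
  have scalar: "c = 0" if "\<And>w. B *v w = c *s w" for c
  proof -
    have "B $ 1 $ 1 = c" "B $ 2 $ 2 = c"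
      using that[of "axis 1 1"] that[of "axis 2 1"]
      by (simp_all add: vec_eq_iff forall_2 matrix_vector_mult_def sum_2 axis_def)
    then show ?thesis
      by (auto simp: B_def imag_quat_eq_quat quat_nth complex_eq_iff)
  qed
  define W where "W = {w. B *v w = \<i> *s w}"
  have "vec.subspace W"
    by (auto simp: W_def vec.subspace_def matrix_vector_right_distrib vector_scalar_commute
        mult.commute)
  moreover have "\<rho> g *v w \<in> W" if "g \<in> carrier (knot_group n)" "w \<in> W" for g w
  proof -
    have "B *v (\<rho> g *v w) = \<rho> g *v (B *v w)"
      by (simp only: matrix_vector_mul_assoc comm[OF that(1)])
    then show ?thesis
      using that(2) by (simp add: W_def vector_scalar_commute)
  qed
  ultimately have "W = {0} \<or> W = UNIV"
    using irr unfolding irreducible_rep_def by blast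
  then show False
  proof
    assume "W = {0}"
    \<comment> \<open>Since \<open>B\<close> squares to \<open>-1\<close>, the map
      \<open>B + \<i>\<close> sends every vector into the \<open>\<i>\<close>-eigenspace. If that is
      zero, \<open>B\<close> is the scalar \<open>- \<i>\<close>.\<close>
    have "B *v w + \<i> *s w \<in> W" for w
      unfolding W_def by (simp add: matrix_vector_right_distrib vector_scalar_commute BB)
    then have "B *v w = (- \<i>) *s w" for w
      using \<open>W = {0}\<close> by (simp add: eq_neg_iff_add_eq_0 vector_smult_lneg)
    then show False using scalar[of "- \<i>"] by simp
  next
    assume "W = UNIV"
    then show False using scalar[of \<i>] by (auto simp: W_def)
  qed
qed

section \<open>Arcs and binary-dihedral characters\<close>

lemma arc_point_iff:
  "arc_point n l1 l2 \<psi> \<rho> \<longleftrightarrow> \<rho> \<in> representations n \<and> irreducible_rep n \<rho> \<and>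
     (\<exists>u v. norm u = 1 \<and> norm v = 1 \<and> arccos (u \<bullet> v) = \<psi> \<and>
        \<rho> (gen_x n) = expq (pi * real l1 / 3) u \<and> \<rho> (gen_y n) = expq (pi * real l2 / real n) v)"
  unfolding arc_point_def unit_angle_def by (metis quat_exp_imag)

lemma imag_quat_commutes_quat:
  assumes "cross3 u w = 0"
  shows "imag_quat u ** quat a w = quat a w ** imag_quat u"
  using assms cross_skew[of w u] by (simp add: imag_quat_eq_quat quat_mult inner_commute)

lemma sin_eq_0_interior:
  assumes "sin (real m * \<theta>) = 0" "0 < \<theta>" "\<theta> < pi" "0 < m"
  obtains l where "0 < l" "l < m" "\<theta> = pi * real l / real m"
proof -
  obtain i :: int where i: "real m * \<theta> = of_int i * pi"
    using assms(1) by (auto simp: sin_zero_iff_int2)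
  have "0 < of_int i * pi" "of_int i * pi < real m * pi"
    using assms(2-4) by (simp_all flip: i)
  then have "0 < i" "i < int m"
    by (simp_all add: zero_less_mult_iff)
  moreover have "\<theta> = pi * real (nat i) / real m"
    using i \<open>0 < i\<close> assms(4) by (simp add: field_simps)
  ultimately show ?thesis using that[of "nat i"] by simp
qed

lemma irreducible_arc_point:
  assumes \<rho>: "\<rho> \<in> representations n" and irr: "irreducible_rep n \<rho>" and n: "0 < n"
  obtains l1 l2 \<psi> where "l1 \<in> {1, 2}" "0 < l2" "l2 < n" "l1 mod 2 = l2 mod 2"
    "0 < \<psi>" "\<psi> < pi" "arc_point n l1 l2 \<psi> \<rho>"
proof -
  interpret \<rho>: group_hom "knot_group n" SU2 \<rho> by (rule representations_hom[OF \<rho>])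
  obtain \<alpha> u where \<alpha>: "0 \<le> \<alpha>" "\<alpha> \<le> pi" "norm u = 1" "\<rho> (gen_x n) = expq \<alpha> u"
    using SU2_eq_expq[of "\<rho> (gen_x n)"] by auto
  obtain \<beta> v where \<beta>: "0 \<le> \<beta>" "\<beta> \<le> pi" "norm v = 1" "\<rho> (gen_y n) = expq \<beta> v"
    using SU2_eq_expq[of "\<rho> (gen_y n)"] by auto
  \<comment> \<open>A unit vector \<open>w\<close> parallel to both imaginary parts would commute
    with both generators.\<close>
  have no: "False" if "norm w = 1" "cross3 w (sin \<alpha> *\<^sub>R u) = 0" "cross3 w (sin \<beta> *\<^sub>R v) = 0" for w
    using irreducible_no_commuting_imag[OF \<rho> irr that(1)] that
    unfolding \<alpha>(4) \<beta>(4) expq_def by (simp add: imag_quat_commutes_quat)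
  \<comment> \<open>The choice \<open>w = u\<close> rules out parallel axes and
    \<open>sin \<beta> = 0\<close>; the choice \<open>w = v\<close> rules out
    \<open>sin \<alpha> = 0\<close>.\<close>
  have cross: "cross3 u v \<noteq> 0" and "sin \<alpha> \<noteq> 0" and "sin \<beta> \<noteq> 0"
    using no[of u] no[of v] \<alpha>(3) \<beta>(3) by (auto simp: cross_mult_right)
  have \<alpha>': "0 < \<alpha>" "\<alpha> < pi" and \<beta>': "0 < \<beta>" "\<beta> < pi"
    using \<open>sin \<alpha> \<noteq> 0\<close> \<open>sin \<beta> \<noteq> 0\<close> \<alpha> \<beta> by (auto simp: less_le)
  have "expq (3 * \<alpha>) u = expq (real n * \<beta>) v"
    using arg_cong[OF knot_group_relation[of n], of \<rho>] \<alpha> \<beta>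
    by (simp add: \<rho>.hom_nat_pow expq_nat_pow)
  then have cos_eq: "cos (3 * \<alpha>) = cos (real n * \<beta>)"
    and sin_eq: "sin (3 * \<alpha>) *\<^sub>R u = sin (real n * \<beta>) *\<^sub>R v"
    by (simp_all add: expq_def)
  \<comment> \<open>The cross product with \<open>v\<close> kills the right side of
    \<open>sin_eq\<close>, while \<open>u\<close> and \<open>v\<close> are independent.\<close>
  have "cross3 (sin (3 * \<alpha>) *\<^sub>R u) v = 0"
    unfolding sin_eq by (simp add: cross_mult_left)
  then have s\<alpha>: "sin (3 * \<alpha>) = 0"
    using cross by (simp add: cross_mult_left)
  with sin_eq have s\<beta>: "sin (real n * \<beta>) = 0"
    using \<beta>(3) by auto
  obtain l1 where l1: "0 < l1" "l1 < 3" "\<alpha> = pi * real l1 / 3"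
    using sin_eq_0_interior[of 3 \<alpha>] s\<alpha> \<alpha>' by auto
  obtain l2 where l2: "0 < l2" "l2 < n" "\<beta> = pi * real l2 / real n"
    using sin_eq_0_interior[of n \<beta>] s\<beta> \<beta>' n by auto
  \<comment> \<open>With \<open>3 \<alpha> = l1 \<pi>\<close> and
    \<open>n \<beta> = l2 \<pi>\<close> the real parts are signs, and their equality is the parity
    condition.\<close>
  have "cos (real l1 * pi) = cos (real l2 * pi)"
    using cos_eq n by (simp add: l1 l2 mult.commute)
  then have par: "l1 mod 2 = l2 mod 2"
    by (auto simp: cos_npi minus_one_power_iff mod2_eq_if split: if_splits)
  \<comment> \<open>Lagrange's identity turns independence of the axes into an angle strictly
    between \<open>0\<close> and \<open>pi\<close>.\<close>
  have "(norm (cross3 u v))\<^sup>2 + (u \<bullet> v)\<^sup>2 = 1"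
    using norm_cross_dot[of u v] \<alpha>(3) \<beta>(3) by simp
  moreover have "0 < (norm (cross3 u v))\<^sup>2"
    using cross by simp
  ultimately have "(u \<bullet> v)\<^sup>2 < 1" by linarith
  then have "\<bar>u \<bullet> v\<bar> < 1"
    by (simp add: abs_square_less_1)
  then have "0 < arccos (u \<bullet> v)" "arccos (u \<bullet> v) < pi"
    using arccos_lt_bounded[of "u \<bullet> v"] by auto
  moreover have "arc_point n l1 l2 (arccos (u \<bullet> v)) \<rho>"
    unfolding arc_point_iff using \<rho> irr \<alpha> \<beta> l1 l2 by auto
  moreover have "l1 \<in> {1, 2}" using l1 by auto
  ultimately show ?thesis using that l2 par by blast
qed

lemma cos_rational_multiple_inj:
  assumes "cos (pi * real l / real m) = cos (pi * real l' / real m)" "l < m" "l' < m"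
  shows "l = l'"
proof -
  have le: "pi * real k / real m \<le> pi" if "k < m" for k
    using that by (simp add: field_simps)
  have "pi * real l / real m = pi * real l' / real m"
    using cos_inj_pi[OF _ le[OF assms(2)] _ le[OF assms(3)] assms(1)] by simp
  then show ?thesis using assms(2) by simp
qed

text \<open>Traces of the generators are constant on a character, and cosine is injective on
  \<open>[0, pi]\<close>.\<close>

lemma arc_labels_unique:
  assumes "arc_point n l1 l2 \<psi> \<rho>" "arc_point n l1' l2' \<psi>' \<rho>'" "character n \<rho> = character n \<rho>'"
    and "l1 \<in> {1, 2}" "l1' \<in> {1, 2}" "l2 < n" "l2' < n"
  shows "l1 = l1'" "l2 = l2'"
proof -
  have reps: "\<rho> \<in> representations n" "\<rho>' \<in> representations n"
    using assms by (auto simp: arc_point_def)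
  have tr: "trace (\<rho>' g) = trace (\<rho> g)" if "g \<in> carrier (knot_group n)" for g
    using trace_character[OF reps(1) _ that] character_self[OF reps(2)] assms(3) by simp
  have "cos (pi * real l1 / 3) = cos (pi * real l1' / 3)"
    "cos (pi * real l2 / real n) = cos (pi * real l2' / real n)"
    using assms(1,2) tr[of "gen_x n"] tr[of "gen_y n"] by (auto simp: arc_point_iff trace_expq)
  then show "l1 = l1'" "l2 = l2'"
    using assms(4-7) cos_rational_multiple_inj[of l1 3 l1'] cos_rational_multiple_inj[of l2 n l2']
    by auto
qed

section \<open>Traceless points on an arc\<close>

lemma trace_meridian:
  assumes "\<rho> \<in> representations n" "norm u = 1" "norm v = 1"
    and "\<rho> (gen_x n) = expq \<alpha> u" "\<rho> (gen_y n) = expq \<beta> v"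
  shows "trace (\<rho> (gen_x n [^]\<^bsub>knot_group n\<^esub> (a::int) \<otimes>\<^bsub>knot_group n\<^esub> gen_y n [^]\<^bsub>knot_group n\<^esub> (b::int)))
    = of_real (2 * (cos (a * \<alpha>) * cos (b * \<beta>) - sin (a * \<alpha>) * sin (b * \<beta>) * (u \<bullet> v)))"
proof -
  interpret \<rho>: group_hom "knot_group n" SU2 \<rho> by (rule representations_hom[OF assms(1)])
  show ?thesis
    by (simp add: \<rho>.hom_int_pow assms expq_int_pow trace_expq_mult)
qed

text \<open>A zero would make \<open>m\<close> divide \<open>a * l\<close>, hence \<open>l\<close>
  by coprimality, contradicting \<open>0 < l < m\<close>.\<close>

lemma sin_rational_multiple_nonzero:
  assumes "coprime a (int m)" "0 < l" "l < m"
  shows "sin (of_int a * (pi * real l / real m)) \<noteq> 0"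
proof
  assume "sin (of_int a * (pi * real l / real m)) = 0"
  then obtain i :: int where "of_int a * (pi * real l / real m) = of_int i * pi"
    by (auto simp: sin_zero_iff_int2)
  then have "real_of_int (a * int l) = real_of_int (i * int m)"
    using assms by (simp add: field_simps)
  then have "a * int l = i * int m" by linarith
  then have "int m dvd a * int l" by simp
  then have "int m dvd int l"
    using assms(1) coprime_dvd_mult_right_iff[of "int m" a] by (simp add: coprime_commute)
  then show False using assms(2,3) zdvd_imp_le by fastforce
qed

lemma traceless_arc_point_unique:
  assumes "coprime 3 n" "l1 \<in> {1, 2}" "0 < l2" "l2 < n"
    and "arc_point n l1 l2 \<psi> \<rho>" "arc_point n l1 l2 \<psi>' \<rho>'" "traceless_rep n \<rho>" "traceless_rep n \<rho>'"
  shows "character n \<rho> = character n \<rho>'"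
proof -
  have "coprime (int n) 3"
    using assms(1) coprime_int_iff[of 3 n] by (simp add: coprime_commute)
  then obtain a b :: int where ab: "a * int n + 3 * b = 1"
    using bezout_int[of "int n" 3] by (auto simp: mult.commute)
  \<comment> \<open>A common divisor in either pair divides \<open>a * int n + 3 * b = 1\<close>.
    This keeps both sines in the coefficient \<open>?s\<close> nonzero.\<close>
  have "coprime a (int 3)" "coprime b (int n)"
    by (rule coprimeI, metis ab dvd_add dvd_mult dvd_mult2 of_nat_numeral)+
  then have s: "sin (a * (pi * real l1 / 3)) \<noteq> 0" "sin (b * (pi * real l2 / real n)) \<noteq> 0"
    using sin_rational_multiple_nonzero[of a 3 l1] sin_rational_multiple_nonzero[of b n l2] assms
    by auto
  obtain u v where uv: "\<rho> \<in> representations n" "norm u = 1" "norm v = 1"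
    "\<rho> (gen_x n) = expq (pi * real l1 / 3) u" "\<rho> (gen_y n) = expq (pi * real l2 / real n) v"
    using assms(5) by (auto simp: arc_point_iff)
  obtain u' v' where uv': "\<rho>' \<in> representations n" "norm u' = 1" "norm v' = 1"
    "\<rho>' (gen_x n) = expq (pi * real l1 / 3) u'" "\<rho>' (gen_y n) = expq (pi * real l2 / real n) v'"
    using assms(6) by (auto simp: arc_point_iff)
  let ?c = "cos (a * (pi * real l1 / 3)) * cos (b * (pi * real l2 / real n))"
  let ?s = "sin (a * (pi * real l1 / 3)) * sin (b * (pi * real l2 / real n))"
  have u: "complex_of_real (2 * (?c - ?s * (u \<bullet> v))) = 0"
    using assms(7) ab unfolding traceless_rep_def trace_meridian[OF uv] by blast
  have u': "complex_of_real (2 * (?c - ?s * (u' \<bullet> v'))) = 0"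
    using assms(8) ab unfolding traceless_rep_def trace_meridian[OF uv'] by blast
  have "?c = ?s * (u \<bullet> v)" "?c = ?s * (u' \<bullet> v')"
    using u u' unfolding of_real_eq_0_iff by simp_all
  then have "?s * (u \<bullet> v) = ?s * (u' \<bullet> v')" by (rule trans[OF sym])
  then have "u \<bullet> v = u' \<bullet> v'"
    using s by simp
  then obtain q where q: "q \<in> carrier SU2" "q ** imag_quat u = imag_quat u' ** q"
    "q ** imag_quat v = imag_quat v' ** q"
    using SU2_conj_pair uv uv' by metis
  \<comment> \<open>An exponential is a combination of \<open>mat 1\<close> and its axis with
    coefficients depending only on \<open>\<theta>\<close>, so conjugating the axes conjugates the
    exponentials.\<close>
  have "q ** expq \<theta> w = expq \<theta> w' ** q" if "q ** imag_quat w = imag_quat w' ** q" for \<theta> w w'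
  proof -
    have e: "expq \<theta> x = cos \<theta> *\<^sub>R mat 1 + sin \<theta> *\<^sub>R imag_quat x" for x
      by (simp add: expq_def mat_1_eq_quat imag_quat_eq_quat scaleR_quat quat_add)
    show ?thesis
      unfolding e by (simp add: matrix_add_ldistrib matrix_add_rdistrib scaleR_matrix_mult that)
  qed
  then show ?thesis
    using character_eqI[OF uv(1) uv'(1) q(1)] q uv uv' by simp
qed

section \<open>The group \<open>Pin2\<close> and binary-dihedral representations\<close>

definition e1 :: "real^3" where "e1 = axis 1 1"
definition e2 :: "real^3" where "e2 = axis 2 1"

lemma e1_e2_simps [simp]: "norm e1 = 1" "norm e2 = 1" "e1 \<bullet> e2 = 0" "e2 \<bullet> e1 = 0" "e1 \<bullet> e1 = 1" "e2 \<bullet> e2 = 1"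
  by (simp_all add: e1_def e2_def norm_axis_1 inner_axis_axis)

lemma quat_i_eq: "quat_i = imag_quat e1" and quat_j_eq: "quat_j = expq (pi / 2) e2"
  by (simp_all add: imag_quat_def e1_def e2_def axis_def expq_def quat_def)

lemma circle_eq: "circle = range (\<lambda>\<phi>. expq \<phi> e1)"
  unfolding circle_def quat_i_eq by (simp add: quat_exp_imag)

text \<open>The units \<open>i\<close> and \<open>j\<close> anticommute, so passing \<open>j\<close>
  across the circle reverses the angle.\<close>

lemma expq_mult_quat_j: "expq \<theta> e1 ** quat_j = quat_j ** expq (- \<theta>) e1"
  using cross_skew[of e1 e2]
  by (simp add: quat_j_eq expq_def quat_mult cross_mult_left cross_mult_right)

text \<open>The circle preserves both of its cosets and \<open>j\<close> exchanges them, because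
  \<open>j\<close> squares to \<open>-1 = expq pi e1\<close>.\<close>

lemma Pin2_mult_closed:
  assumes "P \<in> Pin2"
  shows "expq \<theta> e1 ** P \<in> Pin2" and "quat_j ** P \<in> Pin2"
proof -
  have circ: "z \<in> circle \<Longrightarrow> expq \<theta> e1 ** z \<in> circle" for z \<theta>
    by (auto simp: circle_eq expq_add)
  have jj: "quat_j ** (quat_j ** z) = expq pi e1 ** z" for z
    by (simp add: matrix_mul_assoc) (simp add: quat_j_eq expq_def quat_mult)
  consider "P \<in> circle" | z where "z \<in> circle" "P = quat_j ** z"
    using assms by (auto simp: Pin2_def)
  then show "expq \<theta> e1 ** P \<in> Pin2"
  proof cases
    case 2
    then have "expq \<theta> e1 ** P = quat_j ** (expq (- \<theta>) e1 ** z)"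
      by (simp add: matrix_mul_assoc expq_mult_quat_j)
    then show ?thesis using circ 2 by (auto simp: Pin2_def)
  qed (simp add: circ Pin2_def)
  show "quat_j ** P \<in> Pin2"
    using assms circ by (auto simp: Pin2_def jj)
qed

lemma binary_dihedral_label:
  assumes "arc_point n l1 l2 \<psi> \<rho>" "binary_dihedral_rep n \<rho>" "l1 \<in> {1, 2}" "l2 < n"
  shows "2 * l2 = n"
proof -
  obtain u v where uv: "norm u = 1" "norm v = 1" "\<rho> \<in> representations n" "irreducible_rep n \<rho>"
    "\<rho> (gen_x n) = expq (pi * real l1 / 3) u" "\<rho> (gen_y n) = expq (pi * real l2 / real n) v"
    using assms(1) by (auto simp: arc_point_iff)
  interpret \<rho>: group_hom "knot_group n" SU2 \<rho> by (rule representations_hom[OF uv(3)])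
  obtain A where A: "A \<in> carrier SU2"
    and P: "\<And>g. g \<in> carrier (knot_group n) \<Longrightarrow> A ** \<rho> g ** inv\<^bsub>SU2\<^esub> A \<in> Pin2"
    using assms(2) by (auto simp: binary_dihedral_rep_def)
  let ?B = "inv\<^bsub>SU2\<^esub> A"
  have B: "?B \<in> carrier SU2" "?B ** A = mat 1" "A ** ?B = mat 1"
    using A SU2.l_inv[OF A] SU2.r_inv[OF A] by simp_all
  \<comment> \<open>Undoing the conjugation by \<open>A\<close> carries the axis \<open>i\<close> of
    the circle to \<open>w\<close>; elements conjugated into the circle therefore commute with
    \<open>imag_quat w\<close>.\<close>
  obtain w where w: "?B ** imag_quat e1 = imag_quat w ** ?B"
    using SU2_conj_imag[OF B(1)] .
  have "norm w = 1"
    using inner_conj_imag[OF B(1) w w] by (simp add: norm_eq_1)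
  have comm: "imag_quat w ** \<rho> g = \<rho> g ** imag_quat w"
    if "A ** \<rho> g ** ?B \<in> circle" for g
  proof -
    define Z where "Z = A ** \<rho> g ** ?B"
    have "cross3 e1 (x *\<^sub>R e1) = 0" for x by (simp add: cross_mult_right)
    then have Z: "imag_quat e1 ** Z = Z ** imag_quat e1"
      using that by (auto simp: Z_def circle_eq expq_def imag_quat_commutes_quat)
    have cancel: "M ** A ** ?B = M" "M ** ?B ** A = M" for M
      by (simp_all add: B flip: matrix_mul_assoc)
    have \<rho>g: "\<rho> g = ?B ** Z ** A"
      by (simp add: Z_def matrix_mul_assoc cancel B)
    have w': "imag_quat w = ?B ** imag_quat e1 ** A"
      by (simp add: w cancel)
    have "imag_quat w ** \<rho> g = ?B ** (imag_quat e1 ** Z) ** A"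
      by (simp add: w' \<rho>g matrix_mul_assoc cancel)
    also have "\<dots> = \<rho> g ** imag_quat w"
      unfolding Z by (simp add: w' \<rho>g matrix_mul_assoc cancel)
    finally show ?thesis .
  qed
  have jcircle: "trace (\<rho> g) = 0" if g: "g \<in> carrier (knot_group n)" "A ** \<rho> g ** ?B \<notin> circle" for g
  proof -
    obtain \<phi> where "A ** \<rho> g ** ?B = quat_j ** expq \<phi> e1"
      using P[OF g(1)] g(2) by (auto simp: Pin2_def circle_eq)
    then have "trace (\<rho> g) = trace (quat_j ** expq \<phi> e1)"
      using trace_conj[OF A, of "\<rho> g"] by simp
    then show ?thesis by (simp add: quat_j_eq trace_expq_mult)
  qed
  have "cos (pi * real l1 / 3) \<noteq> 0"
    using assms(3) cos_60 cos_120 by (auto simp: mult.commute)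
  then have "A ** \<rho> (gen_x n) ** ?B \<in> circle"
    using jcircle[of "gen_x n"] by (auto simp: uv trace_expq)
  \<comment> \<open>If both generators landed in the circle, \<open>imag_quat w\<close> would
    commute with both, against irreducibility.\<close>
  then have "A ** \<rho> (gen_y n) ** ?B \<notin> circle"
    using irreducible_no_commuting_imag[OF uv(3,4) \<open>norm w = 1\<close>] comm by blast
  then have eq: "cos (pi * real l2 / real n) = cos (pi / 2)"
    using jcircle[of "gen_y n"] by (simp add: uv trace_expq)
  have le: "pi * real l2 / real n \<le> pi" using assms(4) by (simp add: field_simps)
  have "pi * real l2 / real n = pi / 2"
    using cos_inj_pi[OF _ le _ _ eq] by simp
  then have "real (2 * l2) = real n" using assms(4) by (simp add: field_simps)
  then show ?thesis by linarith
qed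

lemma binary_dihedral_exists:
  assumes "even n"
  obtains \<rho> where "\<rho> \<in> representations n" "irreducible_rep n \<rho>" "traceless_rep n \<rho>"
    "binary_dihedral_rep n \<rho>"
proof -
  obtain m where m: "n = 2 * m" using assms by blast
  \<comment> \<open>Matching the parity of \<open>l\<close> to that of \<open>m\<close> makes
    \<open>(-1)^l\<close>, the cube of \<open>X\<close>, equal to \<open>(-1)^m\<close>, the
    \<open>n\<close>-th power of \<open>j\<close>.\<close>
  obtain l :: nat where l: "l \<in> {1, 2}" "even l \<longleftrightarrow> even m"
    by (metis dvd_refl insertI1 insertI2 odd_one)
  define \<theta> where "\<theta> = pi * real l / 3"
  define X where "X = expq \<theta> e1"
  define Y where "Y = quat_j"
  have XY: "X \<in> carrier SU2" "Y \<in> carrier SU2"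
    by (simp_all add: X_def Y_def quat_j_eq expq_in_SU2)
  have "expq (real l * pi) e1 = expq (real m * pi) e2"
    using l by (simp add: expq_def cos_npi minus_one_power_iff)
  then have "X [^]\<^bsub>SU2\<^esub> (3::nat) = Y [^]\<^bsub>SU2\<^esub> n"
    by (simp add: X_def Y_def quat_j_eq expq_nat_pow \<theta>_def m mult.commute)
  then obtain h where h: "h \<in> hom (knot_group n) SU2" "h (gen_x n) = X" "h (gen_y n) = Y"
    using SU2.knot_group_hom_exists[OF XY] by blast
  define \<rho> where "\<rho> = restrict h (carrier (knot_group n))"
  interpret K: group "knot_group n" by (rule knot_group_is_group)
  have \<rho>: "\<rho> \<in> representations n" and gens: "\<rho> (gen_x n) = X" "\<rho> (gen_y n) = Y"
    using h by (auto simp: representations_def \<rho>_def hom_def)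
  interpret \<rho>: group_hom "knot_group n" SU2 \<rho> by (rule representations_hom[OF \<rho>])
  have sin: "sin \<theta> \<noteq> 0"
    using sin_rational_multiple_nonzero[of 1 3 l] l(1) by (auto simp: \<theta>_def)
  have "irreducible_rep n \<rho>"
    unfolding irreducible_rep_def
  proof (intro allI impI, elim conjE)
    fix W :: "(complex^2) set"
    assume W: "vec.subspace W" and inv: "\<forall>g\<in>carrier (knot_group n). \<forall>w\<in>W. \<rho> g *v w \<in> W"
    have WX: "X *v w \<in> W" and WY: "Y *v w \<in> W" if "w \<in> W" for w
      using inv that gens by (metis gen_in_carrier(1), metis gen_in_carrier(2))
    have X_axis: "X *v w = vector [cis \<theta> * w $ 1, cis (- \<theta>) * w $ 2]" for w
      by (simp add: vec_eq_iff forall_2 matrix_vector_mult_def sum_2 X_def expq_def quat_nth e1_def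
          axis_def complex_eq_iff)
    have Y_axis: "Y *v w = vector [w $ 2, - w $ 1]" for w
      by (simp add: vec_eq_iff forall_2 matrix_vector_mult_def sum_2 Y_def quat_j_def)
    \<comment> \<open>\<open>X\<close> is diagonal with distinct eigenvalues, so a nonzero invariant
      subspace contains a coordinate axis; \<open>Y\<close> swaps the axes up to sign.\<close>
    have "W = UNIV" if w: "w \<in> W" "w \<noteq> 0" for w
    proof -
      have scale: "x \<in> W" if "c *s x \<in> W" "c \<noteq> 0" for c x
        using vec.subspace_scale[OF W that(1), of "inverse c"] that(2) by simp
      have cis: "cis \<theta> - cis (- \<theta>) \<noteq> 0"
        using sin by (simp add: complex_eq_iff)
      have "X *v w - cis (- \<theta>) *s w \<in> W" "X *v w - cis \<theta> *s w \<in> W"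
        using W w(1) WX by (simp_all add: vec.subspace_diff vec.subspace_scale)
      moreover have "X *v w - cis (- \<theta>) *s w = ((cis \<theta> - cis (- \<theta>)) * w $ 1) *s axis 1 1"
        "X *v w - cis \<theta> *s w = (- (cis \<theta> - cis (- \<theta>)) * w $ 2) *s axis 2 1"
        by (simp_all add: X_axis vec_eq_iff forall_2 axis_def algebra_simps)
      ultimately have "w $ 1 \<noteq> 0 \<Longrightarrow> axis 1 1 \<in> W" "w $ 2 \<noteq> 0 \<Longrightarrow> axis 2 1 \<in> W"
        using scale cis by (metis mult_eq_0_iff neg_equal_0_iff_equal)+
      moreover have "axis 1 1 \<in> W \<Longrightarrow> axis 2 1 \<in> W"
      proof -
        assume "axis 1 1 \<in> W"
        moreover have "Y *v axis 1 1 = (- 1) *s axis 2 1"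
          by (simp add: Y_axis vec_eq_iff forall_2 axis_def)
        ultimately have "(- 1) *s axis 2 1 \<in> W"
          using WY[of "axis 1 1"] by simp
        then show "axis 2 1 \<in> W" by (rule scale) simp
      qed
      moreover have "Y *v axis 2 1 = axis 1 1"
        by (simp add: Y_axis vec_eq_iff forall_2 axis_def)
      then have "axis 2 1 \<in> W \<Longrightarrow> axis 1 1 \<in> W"
        using WY[of "axis 2 1"] by simp
      moreover have "w $ 1 \<noteq> 0 \<or> w $ 2 \<noteq> 0"
        using w(2) by (simp add: vec_eq_iff forall_2)
      ultimately have ax: "axis 1 1 \<in> W" "axis 2 1 \<in> W" by blast+
      have "x \<in> W" for x
      proof -
        have "x = x $ 1 *s axis 1 1 + x $ 2 *s axis 2 1"
          by (simp add: vec_eq_iff forall_2 axis_def)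
        then show ?thesis
          using vec.subspace_add[OF W] vec.subspace_scale[OF W] ax by metis
      qed
      then show ?thesis by blast
    qed
    then show "W = {0} \<or> W = UNIV"
      using vec.subspace_0[OF W] by blast
  qed
  moreover have "traceless_rep n \<rho>"
    unfolding traceless_rep_def
  proof (intro allI impI)
    fix a b :: int assume ab: "a * int n + 3 * b = 1"
    \<comment> \<open>As \<open>n\<close> is even, \<open>a * int n + 3 * b = 1\<close> forces
      \<open>b\<close> odd. The cosine term of the trace then vanishes, and the sine term vanishes
      since \<open>e1\<close> and \<open>e2\<close> are orthogonal.\<close>
    have "odd b"
    proof
      assume "even b"
      then have "even (a * int n + 3 * b)" using assms by simp
      then show False unfolding ab by simp
    qed
    then have "cos (of_int b * (pi / 2)) = 0"
      unfolding cos_zero_iff_int by blast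
    then show "trace (\<rho> (gen_x n [^]\<^bsub>knot_group n\<^esub> a \<otimes>\<^bsub>knot_group n\<^esub> gen_y n [^]\<^bsub>knot_group n\<^esub> b)) = 0"
      using trace_meridian[OF \<rho> _ _ gens[unfolded X_def Y_def quat_j_eq], of a b] by simp
  qed
  moreover have "binary_dihedral_rep n \<rho>"
  proof -
    \<comment> \<open>The inverse \<open>- j\<close> is written as \<open>j\<close> times
      \<open>expq pi e1\<close>, so that the two closure rules of \<open>Pin2\<close> apply.\<close>
    have inv: "inv\<^bsub>SU2\<^esub> X = expq (- \<theta>) e1" "inv\<^bsub>SU2\<^esub> Y = quat_j ** expq pi e1"
      unfolding X_def Y_def quat_j_eq by (simp_all add: expq_inv) (simp add: expq_def quat_mult)
    have "\<rho> g \<in> Pin2" if "g \<in> carrier (knot_group n)" for g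
      using that
    proof (induction rule: knot_group_induct)
      case one
      have "mat 1 = expq 0 e1" by (simp add: expq_def mat_1_eq_quat)
      then show ?case by (auto simp: Pin2_def circle_eq)
    next
      case (x g)
      then show ?case using Pin2_mult_closed(1) by (simp add: gens X_def)
    next
      case (inv_x g)
      then show ?case using Pin2_mult_closed(1) by (simp add: gens inv)
    next
      case (y g)
      then show ?case using Pin2_mult_closed(2) by (simp add: gens Y_def)
    next
      case (inv_y g)
      then have "quat_j ** (expq pi e1 ** \<rho> g) \<in> Pin2" using Pin2_mult_closed by simp
      then show ?case using inv_y by (simp add: gens inv matrix_mul_assoc)
    qed
    then show ?thesis
      unfolding binary_dihedral_rep_def using SU2.one_closed SU2.inv_one by (intro bexI[of _ "mat 1"]) auto
  qed
  ultimately show ?thesis using that \<rho> by blast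
qed

section \<open>The bijection with traceless arcs and the dihedral count\<close>

theorem theorem1p2:
  fixes n :: nat
  assumes "n \<ge> 2" and "coprime 3 n"
  defines "T \<equiv> irreducible_traceless_characters n"
  defines "D \<equiv> {\<xi> \<in> T. binary_dihedral_character n \<xi>}"
  shows "(\<exists>f. bij_betw f T (traceless_arcs n) \<and> (\<forall>\<xi>\<in>T. \<xi> \<in> f \<xi>))
    \<and> (\<forall>A\<in>traceless_arcs n. \<exists>!\<xi>. \<xi> \<in> T \<and> \<xi> \<in> A)
    \<and> finite D \<and> real (card D) = (real_of_int (knot_det n) - 1) / 2
    \<and> (even n \<longrightarrow> knot_det n = 3 \<and> card D = 1)
    \<and> (odd n \<longrightarrow> knot_det n = 1 \<and> D = {})
    \<and> (odd n \<longrightarrow> (\<forall>\<xi>\<in>T. \<not> binary_dihedral_character n \<xi>))"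
proof -
  define valid where
    "valid l1 l2 \<longleftrightarrow> l1 \<in> {1, 2} \<and> 0 < l2 \<and> l2 < n \<and> l1 mod 2 = l2 mod 2" for l1 l2
  have arcs: "A \<in> representation_arcs n \<longleftrightarrow> (\<exists>l1 l2. valid l1 l2 \<and> A = representation_arc n l1 l2)" for A
    by (auto simp: representation_arcs_def valid_def)
  have T_iff: "\<xi> \<in> T \<longleftrightarrow> (\<exists>\<rho>. \<rho> \<in> representations n \<and> irreducible_rep n \<rho> \<and> traceless_rep n \<rho>
      \<and> \<xi> = character n \<rho>)" for \<xi>
    by (auto simp: T_def irreducible_traceless_characters_def)
  \<comment> \<open>A traceless arc only provides some traceless member of a character; invariance
    of the trace moves tracelessness to the member exhibiting the arc.\<close>
  have arc_traceless: "\<exists>\<rho> \<psi>. arc_point n l1 l2 \<psi> \<rho> \<and> traceless_rep n \<rho> \<and> \<xi> = character n \<rho>"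
    if arc: "\<xi> \<in> representation_arc n l1 l2" and \<sigma>: "\<sigma> \<in> \<xi>" "traceless_rep n \<sigma>" for \<xi> l1 l2 \<sigma>
  proof -
    obtain \<rho> \<psi> where "\<xi> = character n \<rho>" "arc_point n l1 l2 \<psi> \<rho>"
      using arc by (auto simp: representation_arc_def)
    then show ?thesis
      using \<sigma> traceless_character by (metis arc_point_def)
  qed
  have T_arc: "\<exists>l1 l2. valid l1 l2 \<and> \<xi> \<in> representation_arc n l1 l2" if T: "\<xi> \<in> T" for \<xi>
  proof -
    obtain \<rho> where \<rho>: "\<rho> \<in> representations n" "irreducible_rep n \<rho>" "\<xi> = character n \<rho>"
      using T by (auto simp: T_iff)
    moreover have "0 < n" using assms(1) by simp
    ultimately obtain l1 l2 \<psi> where "l1 \<in> {1, 2}" "0 < l2" "l2 < n" "l1 mod 2 = l2 mod 2"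
      "0 < \<psi>" "\<psi> < pi" "arc_point n l1 l2 \<psi> \<rho>"
      using irreducible_arc_point by metis
    then have "valid l1 l2" "\<xi> \<in> representation_arc n l1 l2"
      unfolding valid_def representation_arc_def \<rho>(3) by blast+
    then show ?thesis by blast
  qed
  have T_traceless: "\<exists>\<sigma>\<in>\<xi>. traceless_rep n \<sigma>" if "\<xi> \<in> T" for \<xi>
    using that character_self by (auto simp: T_iff)
  have arc_unique: "\<xi> = \<xi>'" if *: "\<xi> \<in> T" "\<xi>' \<in> T" "valid l1 l2"
    "\<xi> \<in> representation_arc n l1 l2" "\<xi>' \<in> representation_arc n l1 l2" for \<xi> \<xi>' l1 l2
  proof -
    have l: "l1 \<in> {1, 2}" "0 < l2" "l2 < n"
      using *(3) by (simp_all add: valid_def)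
    obtain \<rho> \<psi> where \<rho>: "arc_point n l1 l2 \<psi> \<rho>" "traceless_rep n \<rho>" "\<xi> = character n \<rho>"
      using arc_traceless * T_traceless by meson
    obtain \<rho>' \<psi>' where \<rho>': "arc_point n l1 l2 \<psi>' \<rho>'" "traceless_rep n \<rho>'" "\<xi>' = character n \<rho>'"
      using arc_traceless * T_traceless by meson
    show ?thesis
      unfolding \<rho>(3) \<rho>'(3)
      by (rule traceless_arc_point_unique[OF assms(2) l \<rho>(1) \<rho>'(1) \<rho>(2) \<rho>'(2)])
  qed
  have labels_unique: "l1 = l1' \<and> l2 = l2'" if "valid l1 l2" "valid l1' l2'"
    "\<xi> \<in> representation_arc n l1 l2" "\<xi> \<in> representation_arc n l1' l2'" for \<xi> l1 l2 l1' l2'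
    using that arc_labels_unique unfolding representation_arc_def valid_def by blast
  have arc_exists: "\<exists>\<xi>. \<xi> \<in> T \<and> \<xi> \<in> A" if A: "A \<in> traceless_arcs n" for A
  proof -
    obtain l1 l2 \<xi> \<sigma> where *: "A = representation_arc n l1 l2" "\<xi> \<in> A" "\<sigma> \<in> \<xi>" "traceless_rep n \<sigma>"
      using A by (auto simp: traceless_arcs_def arcs)
    then have "\<xi> \<in> T" using arc_traceless unfolding T_iff arc_point_def by blast
    then show ?thesis using * by blast
  qed
  have traceless_arcD: "\<exists>l1 l2. valid l1 l2 \<and> A = representation_arc n l1 l2"
    if "A \<in> traceless_arcs n" for A
    using that by (auto simp: traceless_arcs_def arcs)
  have ex1: "\<forall>A\<in>traceless_arcs n. \<exists>!\<xi>. \<xi> \<in> T \<and> \<xi> \<in> A"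
  proof
    fix A assume A: "A \<in> traceless_arcs n"
    obtain l1 l2 where l: "valid l1 l2" "A = representation_arc n l1 l2"
      using traceless_arcD[OF A] by blast
    obtain \<xi> where \<xi>: "\<xi> \<in> T" "\<xi> \<in> A"
      using arc_exists[OF A] by blast
    show "\<exists>!\<xi>. \<xi> \<in> T \<and> \<xi> \<in> A"
    proof (rule ex1I[of _ \<xi>])
      fix \<xi>' assume "\<xi>' \<in> T \<and> \<xi>' \<in> A"
      then show "\<xi>' = \<xi>"
        using arc_unique[OF _ \<xi>(1) l(1)] \<xi>(2) unfolding l(2) by blast
    qed (use \<xi> in blast)
  qed
  have ex_arc: "\<forall>\<xi>\<in>T. \<exists>A\<in>traceless_arcs n. \<xi> \<in> A"
  proof
    fix \<xi> assume \<xi>: "\<xi> \<in> T"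
    obtain l1 l2 where l: "valid l1 l2" "\<xi> \<in> representation_arc n l1 l2"
      using T_arc[OF \<xi>] by blast
    then have "representation_arc n l1 l2 \<in> traceless_arcs n"
      using arcs T_traceless[OF \<xi>] by (auto simp: traceless_arcs_def)
    then show "\<exists>A\<in>traceless_arcs n. \<xi> \<in> A" using l(2) by blast
  qed
  \<comment> \<open>Any choice of a traceless arc through each character will do, since
    \<open>arc_of\<close> below leaves just one.\<close>
  then obtain f where f: "\<forall>\<xi>\<in>T. f \<xi> \<in> traceless_arcs n \<and> \<xi> \<in> f \<xi>"
    using bchoice[of T "\<lambda>\<xi> A. A \<in> traceless_arcs n \<and> \<xi> \<in> A"] by (auto simp: Bex_def)
  have arc_of: "A = B" if A: "A \<in> traceless_arcs n" and B: "B \<in> traceless_arcs n"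
    and \<xi>: "\<xi> \<in> A" "\<xi> \<in> B" for A B \<xi>
  proof -
    obtain l1 l2 l1' l2' where l: "valid l1 l2" "A = representation_arc n l1 l2"
      "valid l1' l2'" "B = representation_arc n l1' l2'"
      using traceless_arcD[OF A] traceless_arcD[OF B] by blast
    then show ?thesis
      using labels_unique[OF l(1,3)] \<xi> by blast
  qed
  have "bij_betw f T (traceless_arcs n)"
  proof (rule bij_betw_imageI)
    show "inj_on f T"
    proof (rule inj_onI)
      fix \<xi> \<xi>' assume "\<xi> \<in> T" "\<xi>' \<in> T" "f \<xi> = f \<xi>'"
      then show "\<xi> = \<xi>'" using f ex1 by metis
    qed
    show "f ` T = traceless_arcs n"
    proof
      show "traceless_arcs n \<subseteq> f ` T"
      proof
        fix A assume A: "A \<in> traceless_arcs n"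
        obtain \<xi> where \<xi>: "\<xi> \<in> T" "\<xi> \<in> A"
          using arc_exists[OF A] by blast
        then have "f \<xi> = A" using arc_of[OF _ A] f by blast
        then show "A \<in> f ` T" using \<xi> by blast
      qed
    qed (use f in blast)
  qed
  then have bij: "\<exists>f. bij_betw f T (traceless_arcs n) \<and> (\<forall>\<xi>\<in>T. \<xi> \<in> f \<xi>)"
    using f by blast

  have D_label: "\<exists>l1 l2. valid l1 l2 \<and> 2 * l2 = n \<and> \<xi> \<in> representation_arc n l1 l2" if "\<xi> \<in> D" for \<xi>
  proof -
    have \<xi>: "\<xi> \<in> T" "binary_dihedral_character n \<xi>" using that by (auto simp: D_def)
    obtain l1 l2 where l: "valid l1 l2" "\<xi> \<in> representation_arc n l1 l2"
      using T_arc[OF \<xi>(1)] by blast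
    obtain \<rho> \<psi> where \<rho>: "\<xi> = character n \<rho>" "arc_point n l1 l2 \<psi> \<rho>"
      using l(2) by (auto simp: representation_arc_def)
    have "binary_dihedral_rep n \<rho>"
      using \<xi>(2) \<rho> binary_dihedral_rep_character unfolding binary_dihedral_character_def arc_point_def by blast
    then show ?thesis
      using binary_dihedral_label[OF \<rho>(2)] l by (auto simp: valid_def)
  qed
  have D_unique: "\<xi> = \<xi>'" if D: "\<xi> \<in> D" "\<xi>' \<in> D" for \<xi> \<xi>'
  proof -
    obtain l1 l2 where l: "valid l1 l2" "2 * l2 = n" "\<xi> \<in> representation_arc n l1 l2"
      using D_label D by blast
    obtain l1' l2' where l': "valid l1' l2'" "2 * l2' = n" "\<xi>' \<in> representation_arc n l1' l2'"
      using D_label D by blast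
    \<comment> \<open>The equation \<open>2 * l2 = n\<close> fixes \<open>l2\<close>, and its parity
      then selects \<open>l1\<close> from \<open>{1, 2}\<close>: at most one arc can carry a
      dihedral traceless character.\<close>
    have "l2' = l2" "l1' = l1"
      using l(1,2) l'(1,2) by (auto simp: valid_def)
    then show ?thesis
      using arc_unique[of \<xi> \<xi>' l1 l2] l l' D by (auto simp: D_def)
  qed
  have det: "knot_det n = (if even n then 3 else 1)"
    by (rule knot_det_eq[OF assms(2)])
  have D_odd: "D = {}" if "odd n"
    using D_label that by fastforce
  have D_even: "\<exists>\<xi>. D = {\<xi>}" if even: "even n"
  proof -
    obtain \<rho> where "\<rho> \<in> representations n" "irreducible_rep n \<rho>" "traceless_rep n \<rho>"
      "binary_dihedral_rep n \<rho>"
      using binary_dihedral_exists[OF even] .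
    then have "character n \<rho> \<in> D"
      using character_self by (auto simp: D_def T_iff binary_dihedral_character_def)
    then show ?thesis using D_unique by blast
  qed
  have "finite D \<and> real (card D) = (real_of_int (knot_det n) - 1) / 2
    \<and> (even n \<longrightarrow> knot_det n = 3 \<and> card D = 1) \<and> (odd n \<longrightarrow> knot_det n = 1 \<and> D = {})"
    using D_odd D_even det by (cases "even n") auto
  moreover have "odd n \<longrightarrow> (\<forall>\<xi>\<in>T. \<not> binary_dihedral_character n \<xi>)"
    using D_odd by (auto simp: D_def)
  ultimately show ?thesis using bij ex1 by blast
qed

end
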